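(* For every integer $n\ge0$: $$\dim(\mathbf{WQSym}_n)=\#\{\text{blue-packed forests of size } n\},\qquad \dim(\mathrm{Prim}_n)=\#\{\text{blue-packed trees of size } n\},$$ $$\dim(\mathrm{TPrim}_n)=\#\{\text{blue-packed trees of size } n \text{ whose root has empty left forest}\}.$$
   Context: Words are finite words over the positive integers; $|w|$ is the length, $\max(w)$ the largest letter ($\max(\varepsilon)=0$). A word $w$ is packed if every integer $1,\dots,\max(w)$ occurs in it; $\mathrm{PW}_n$ is the set of packed words of length $n$. $\mathrm{pack}(w)$ replaces the $j$-th smallest distinct letter of $w$ by $j$; $u|_{\le i}$ (resp. $u|_{>i}$) is the subword of letters $\le i$ (resp. $>i$). $\mathbf{WQSym}_n$ is the vector space with basis $(\mathbb{Q}_w)_{w\in\mathrm{PW}_n}$. For $u=u_1\cdots u_n\in\mathrm{PW}_n$, $n\ge1$, define $\Delta_\prec(\mathbb{Q}_u)=\sum_{i=u_n}^{\max(u)-1}\mathbb{Q}_{u|_{\le i}}\otimes\mathbb{Q}_{\mathrm{pack}(u|_{>i})}$ and $\Delta_\succ(\mathbb{Q}_u)=\sum_{i=1}^{u_n-1}\mathbb{Q}_{u|_{\le i}}\otimes\mathbb{Q}_{\mathrm{pack}(u|_{>i})}$, extended linearly. For $n\ge1$, $\mathrm{Prim}_n=\mathbf{WQSym}_n\cap\ker(\Delta_\prec+\Delta_\succ)$ and $\mathrm{TPrim}_n=\mathbf{WQSym}_n\cap\ker\Delta_\prec\cap\ker\Delta_\succ$ (both $0$ for $n=0$). A biplane tree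 with labels in $L$ is recursively $\mathrm{Node}(x,f_\ell,f_r)$ with root label $x\in L$ and $f_\ell,f_r$ (left and right forests) finite ordered, possibly empty, lists of such trees; a forest is a finite ordered list of trees. Blue-packed trees have labels $i^\alpha$ with $i$ a positive integer and $\alpha\in\{\circ,\bullet\}$. The weight $\omega$ of a tree (or forest) is its number of nodes whose label has $\alpha=\circ$; its size is its total number of nodes. A tree $t=\mathrm{Node}(i^\alpha,[\ell_1,\dots,\ell_g],[r_1,\dots,r_d])$ is blue-packed if all $\ell_j,r_j$ are blue-packed and either ($d=0$ and $i^\alpha=1^\circ$) or ($d=1$, $i^\alpha\ne1^\circ$ and $1\le i\le\omega(r_1)$). A blue-packed forest is a list of blue-packed trees. *)

theory Defs
  imports Complex_Main "HOL-Library.Poly_Mapping"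
begin

section \<open>Packed words\<close>

definition wmax :: "nat list \<Rightarrow> nat" where
  "wmax w = Max (insert 0 (set w))"

definition packed :: "nat list \<Rightarrow> bool" where
  "packed w \<longleftrightarrow> (\<forall>a\<in>set w. 1 \<le> a) \<and> (\<forall>i\<in>{1..wmax w}. i \<in> set w)"

definition PW :: "nat \<Rightarrow> nat list set" where
  "PW n = {w. packed w \<and> length w = n}"

text \<open>A letter \<open>a\<close> of \<open>w\<close> is the \<open>j\<close>-th smallest distinct letter for
  \<open>j\<close> the number of distinct letters of \<open>w\<close> that are at most \<open>a\<close>.\<close>

definition pack :: "nat list \<Rightarrow> nat list" where
  "pack w = map (\<lambda>a. card {b \<in> set w. b \<le> a}) w"

definition letters_le :: "nat list \<Rightarrow> nat \<Rightarrow> nat list" where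
  "letters_le u i = filter (\<lambda>a. a \<le> i) u"

definition letters_gt :: "nat list \<Rightarrow> nat \<Rightarrow> nat list" where
  "letters_gt u i = filter (\<lambda>a. a > i) u"

lemma finite_PW: "finite (PW n)"
proof -
  have "set w \<subseteq> {0..n} \<and> length w = n" if "w \<in> PW n" for w
  proof -
    from that have p: "{1..wmax w} \<subseteq> set w" and l: "length w = n"
      unfolding PW_def packed_def by blast+
    have "card {1..wmax w} \<le> card (set w)"
      using p by (intro card_mono) auto
    also have "\<dots> \<le> n"
      using card_length l by metis
    finally have "wmax w \<le> n"
      by simp
    moreover have "a \<le> wmax w" if "a \<in> set w" for a
      using that by (simp add: wmax_def)
    ultimately have "set w \<subseteq> {0..n}"
      by (meson atLeastAtMost_iff le0 order_trans subsetI)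
    then show ?thesis
      using l by simp
  qed
  then have "PW n \<subseteq> {w. set w \<subseteq> {0..n} \<and> length w = n}"
    by blast
  then show ?thesis
    using finite_lists_length_eq[of "{0..n}" n] finite_subset by blast
qed


section \<open>Free vector spaces\<close>

text \<open>The type \<open>'a \<Rightarrow>\<^sub>0 'k\<close> of finitely supported functions is the vector space
  over \<open>'k\<close> with basis \<open>'a\<close>; the basis vector of \<open>x\<close> is \<open>Poly_Mapping.single x 1\<close>.\<close>

definition pm_scale :: "'k::field \<Rightarrow> ('a \<Rightarrow>\<^sub>0 'k) \<Rightarrow> ('a \<Rightarrow>\<^sub>0 'k)" where
  "pm_scale c p = Poly_Mapping.map ((*) c) p"

lemma lookup_pm_scale [simp]:
  "Poly_Mapping.lookup (pm_scale c p) x = c * Poly_Mapping.lookup p x"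
  by (simp add: pm_scale_def map.rep_eq when_def)

interpretation free_vs: vector_space "pm_scale :: 'k::field \<Rightarrow> ('a \<Rightarrow>\<^sub>0 'k) \<Rightarrow> ('a \<Rightarrow>\<^sub>0 'k)"
  by standard (auto intro!: poly_mapping_eqI simp: lookup_add algebra_simps)

definition lin_extend :: "('a \<Rightarrow> ('b \<Rightarrow>\<^sub>0 'k::field)) \<Rightarrow> ('a \<Rightarrow>\<^sub>0 'k) \<Rightarrow> ('b \<Rightarrow>\<^sub>0 'k)" where
  "lin_extend f p = (\<Sum>x\<in>Poly_Mapping.keys p. pm_scale (Poly_Mapping.lookup p x) (f x))"

lemma lin_extend_superset:
  assumes "finite A" "Poly_Mapping.keys p \<subseteq> A"
  shows "lin_extend f p = (\<Sum>x\<in>A. pm_scale (Poly_Mapping.lookup p x) (f x))"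
  unfolding lin_extend_def
  by (rule sum.mono_neutral_left) (use assms in \<open>auto simp: in_keys_iff\<close>)

lemma lin_extend_single [simp]: "lin_extend f (Poly_Mapping.single x 1) = f x"
  by (simp add: lin_extend_def)

lemma linear_lin_extend:
  "Vector_Spaces.linear pm_scale pm_scale (lin_extend (f :: 'a \<Rightarrow> ('b \<Rightarrow>\<^sub>0 'k::field)))"
proof (unfold_locales)
  fix p q :: "'a \<Rightarrow>\<^sub>0 'k" and c :: 'k
  let ?A = "Poly_Mapping.keys p \<union> Poly_Mapping.keys q"
  have "lin_extend f (p + q) = (\<Sum>x\<in>?A. pm_scale (Poly_Mapping.lookup (p + q) x) (f x))"
    by (rule lin_extend_superset) (simp_all add: Poly_Mapping.keys_add)
  also have "\<dots> = (\<Sum>x\<in>?A. pm_scale (Poly_Mapping.lookup p x) (f x)) +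
                  (\<Sum>x\<in>?A. pm_scale (Poly_Mapping.lookup q x) (f x))"
    by (simp add: lookup_add free_vs.scale_left_distrib sum.distrib)
  also have "\<dots> = lin_extend f p + lin_extend f q"
    by (simp add: lin_extend_superset[of ?A])
  finally show "lin_extend f (p + q) = lin_extend f p + lin_extend f q" .
  have "lin_extend f (pm_scale c p) =
      (\<Sum>x\<in>Poly_Mapping.keys p. pm_scale (Poly_Mapping.lookup (pm_scale c p) x) (f x))"
    by (rule lin_extend_superset) (auto simp: in_keys_iff)
  then show "lin_extend f (pm_scale c p) = pm_scale c (lin_extend f p)"
    by (simp add: lin_extend_def free_vs.scale_sum_right)
qed


section \<open>The graded components of WQSym and their primitive elements\<close>

definition WQSym :: "nat \<Rightarrow> (nat list \<Rightarrow>\<^sub>0 'k::field) set" where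
  "WQSym n = {p. Poly_Mapping.keys p \<subseteq> PW n}"

text \<open>Tensors are represented in the free vector space on pairs of words:
  \<open>Q_tensor u v\<close> stands for the tensor product of the basis vectors of \<open>u\<close> and \<open>v\<close>.\<close>

definition Q_tensor :: "nat list \<Rightarrow> nat list \<Rightarrow> (nat list \<times> nat list \<Rightarrow>\<^sub>0 'k::field)" where
  "Q_tensor u v = Poly_Mapping.single (u, v) 1"

definition Delta_prec :: "(nat list \<Rightarrow>\<^sub>0 'k::field) \<Rightarrow> (nat list \<times> nat list \<Rightarrow>\<^sub>0 'k)" where
  "Delta_prec = lin_extend
     (\<lambda>u. \<Sum>i\<in>{last u..<wmax u}. Q_tensor (letters_le u i) (pack (letters_gt u i)))"

definition Delta_succ :: "(nat list \<Rightarrow>\<^sub>0 'k::field) \<Rightarrow> (nat list \<times> nat list \<Rightarrow>\<^sub>0 'k)" where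
  "Delta_succ = lin_extend
     (\<lambda>u. \<Sum>i\<in>{1..<last u}. Q_tensor (letters_le u i) (pack (letters_gt u i)))"

definition Prim :: "nat \<Rightarrow> (nat list \<Rightarrow>\<^sub>0 'k::field) set" where
  "Prim n = (if n = 0 then {0}
     else {p \<in> WQSym n. Delta_prec p + Delta_succ p = 0})"

definition TPrim :: "nat \<Rightarrow> (nat list \<Rightarrow>\<^sub>0 'k::field) set" where
  "TPrim n = (if n = 0 then {0}
     else {p \<in> WQSym n. Delta_prec p = 0 \<and> Delta_succ p = 0})"

lemma subspace_WQSym: "free_vs.subspace (WQSym n :: (nat list \<Rightarrow>\<^sub>0 'k::field) set)"
proof -
  have "Poly_Mapping.keys (p + q) \<subseteq> PW n"
    if "Poly_Mapping.keys p \<subseteq> PW n" "Poly_Mapping.keys q \<subseteq> PW n" for p q :: "nat list \<Rightarrow>\<^sub>0 'k::field"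
    using that Poly_Mapping.keys_add[of p q] by blast
  moreover have "Poly_Mapping.keys (pm_scale c p) \<subseteq> PW n"
    if "Poly_Mapping.keys p \<subseteq> PW n" for c and p :: "nat list \<Rightarrow>\<^sub>0 'k::field"
    using that by (auto simp: in_keys_iff)
  ultimately show ?thesis
    unfolding free_vs.subspace_def WQSym_def by simp
qed

lemma subspace_Prim: "free_vs.subspace (Prim n :: (nat list \<Rightarrow>\<^sub>0 'k::field) set)"
proof -
  interpret P: Vector_Spaces.linear pm_scale pm_scale Delta_prec
    unfolding Delta_prec_def by (rule linear_lin_extend)
  interpret S: Vector_Spaces.linear pm_scale pm_scale Delta_succ
    unfolding Delta_succ_def by (rule linear_lin_extend)
  have add: "Delta_prec (p + q) + Delta_succ (p + q) =
      (Delta_prec p + Delta_succ p) + (Delta_prec q + Delta_succ q)" for p q :: "nat list \<Rightarrow>\<^sub>0 'k::field"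
    by (simp only: P.add S.add ac_simps)
  have scale: "Delta_prec (pm_scale c p) + Delta_succ (pm_scale c p) =
      pm_scale c (Delta_prec p + Delta_succ p)" for c and p :: "nat list \<Rightarrow>\<^sub>0 'k::field"
    by (simp only: P.scale S.scale free_vs.scale_right_distrib)
  show ?thesis
    using subspace_WQSym[of n] unfolding free_vs.subspace_def Prim_def
    by (auto simp: add scale P.zero S.zero)
qed

lemma subspace_TPrim: "free_vs.subspace (TPrim n :: (nat list \<Rightarrow>\<^sub>0 'k::field) set)"
proof -
  interpret P: Vector_Spaces.linear pm_scale pm_scale Delta_prec
    unfolding Delta_prec_def by (rule linear_lin_extend)
  interpret S: Vector_Spaces.linear pm_scale pm_scale Delta_succ
    unfolding Delta_succ_def by (rule linear_lin_extend)
  show ?thesis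
    using subspace_WQSym[of n] unfolding free_vs.subspace_def TPrim_def
    by (auto simp: P.add S.add P.scale S.scale P.zero S.zero)
qed


section \<open>Biplane trees and blue-packed trees\<close>

datatype 'l biplane_tree = Node 'l "'l biplane_tree list" "'l biplane_tree list"

datatype mark = Circ | Bullet

type_synonym blue_label = "nat \<times> mark"

fun weight :: "blue_label biplane_tree \<Rightarrow> nat" where
  "weight (Node x fl fr) =
     (if snd x = Circ then 1 else 0) + sum_list (map weight fl) + sum_list (map weight fr)"

fun tree_size :: "'l biplane_tree \<Rightarrow> nat" where
  "tree_size (Node x fl fr) =
     1 + sum_list (map tree_size fl) + sum_list (map tree_size fr)"

definition forest_size :: "'l biplane_tree list \<Rightarrow> nat" where
  "forest_size f = sum_list (map tree_size f)"

fun left_forest :: "'l biplane_tree \<Rightarrow> 'l biplane_tree list" where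
  "left_forest (Node x fl fr) = fl"

fun blue_packed :: "blue_label biplane_tree \<Rightarrow> bool" where
  "blue_packed (Node (i, \<alpha>) fl fr) \<longleftrightarrow>
     (\<forall>t\<in>set fl. blue_packed t) \<and> (\<forall>t\<in>set fr. blue_packed t) \<and>
     ((fr = [] \<and> (i, \<alpha>) = (1, Circ)) \<or>
      (\<exists>r. fr = [r] \<and> (i, \<alpha>) \<noteq> (1, Circ) \<and> 1 \<le> i \<and> i \<le> weight r))"

definition blue_packed_trees :: "nat \<Rightarrow> blue_label biplane_tree set" where
  "blue_packed_trees n = {t. blue_packed t \<and> tree_size t = n}"

definition blue_packed_forests :: "nat \<Rightarrow> blue_label biplane_tree list set" where
  "blue_packed_forests n = {f. (\<forall>t\<in>set f. blue_packed t) \<and> forest_size f = n}"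

lemma tree_size_pos: "0 < tree_size t"
  by (cases t) simp

lemma weight_le_tree_size: "weight t \<le> tree_size t"
proof (induction t)
  case (Node x fl fr)
  have "sum_list (map weight fl) \<le> sum_list (map tree_size fl)"
    "sum_list (map weight fr) \<le> sum_list (map tree_size fr)"
    using Node by (auto intro!: sum_list_mono)
  then show ?case
    by simp
qed

lemma length_le_forest_size: "length f \<le> forest_size f"
proof (induction f)
  case (Cons t f)
  then show ?case
    using tree_size_pos[of t] by (simp add: forest_size_def)
qed (simp add: forest_size_def)

lemma tree_size_le_forest_size: "t \<in> set f \<Longrightarrow> tree_size t \<le> forest_size f"
  unfolding forest_size_def by (rule member_le_sum_list) auto

lemma finite_forests_of_finite_trees:
  assumes "finite {t. blue_packed t \<and> tree_size t \<le> n}"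
  shows "finite {f. (\<forall>t\<in>set f. blue_packed t) \<and> forest_size f \<le> n}"
proof (rule finite_subset)
  show "{f. (\<forall>t\<in>set f. blue_packed t) \<and> forest_size f \<le> n} \<subseteq>
      {f. set f \<subseteq> {t. blue_packed t \<and> tree_size t \<le> n} \<and> length f \<le> n}"
    using length_le_forest_size tree_size_le_forest_size order_trans by blast
  show "finite {f. set f \<subseteq> {t. blue_packed t \<and> tree_size t \<le> n} \<and> length f \<le> n}"
    by (rule finite_lists_length_le[OF assms])
qed

lemma finite_blue_packed_le: "finite {t. blue_packed t \<and> tree_size t \<le> n}"
proof (induction n)
  case 0
  have "{t. blue_packed t \<and> tree_size t \<le> 0} = {}"
    by (auto simp: tree_size_pos[THEN less_imp_neq, symmetric])
  then show ?case
    by (metis finite.emptyI)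
next
  case (Suc n)
  let ?F = "{f. (\<forall>t\<in>set f. blue_packed t) \<and> forest_size f \<le> n}"
  let ?L = "{0..Suc n} \<times> {Circ, Bullet}"
  have "t \<in> (\<lambda>(x, fl, fr). Node x fl fr) ` (?L \<times> ?F \<times> ?F)"
    if t: "blue_packed t" "tree_size t \<le> Suc n" for t
  proof -
    obtain i \<alpha> fl fr where t_eq: "t = Node (i, \<alpha>) fl fr"
      by (metis biplane_tree.exhaust surj_pair)
    have "fl \<in> ?F" "fr \<in> ?F"
      using t by (auto simp: t_eq forest_size_def)
    moreover have "i \<le> Suc n"
    proof -
      have "i \<le> weight r \<and> tree_size r \<le> n" if "fr = [r]" "(i, \<alpha>) \<noteq> (1, Circ)" for r
        using t that by (auto simp: t_eq)
      then show ?thesis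
        using t weight_le_tree_size by (fastforce simp: t_eq intro: order_trans)
    qed
    moreover have "\<alpha> \<in> {Circ, Bullet}"
      by (cases \<alpha>) auto
    ultimately have "((i, \<alpha>), fl, fr) \<in> ?L \<times> ?F \<times> ?F"
      by simp
    then show ?thesis
      unfolding t_eq by (rule rev_image_eqI) simp
  qed
  then have "{t. blue_packed t \<and> tree_size t \<le> Suc n} \<subseteq>
      (\<lambda>(x, fl, fr). Node x fl fr) ` (?L \<times> ?F \<times> ?F)"
    by blast
  moreover have "finite ((\<lambda>(x, fl, fr). Node x fl fr) ` (?L \<times> ?F \<times> ?F))"
    using finite_forests_of_finite_trees[OF Suc.IH]
    by (intro finite_imageI finite_cartesian_product) simp_all
  ultimately show ?case
    by (rule finite_subset)
qed

lemma finite_blue_packed_trees: "finite (blue_packed_trees n)"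
  unfolding blue_packed_trees_def
  by (rule finite_subset[OF _ finite_blue_packed_le[of n]]) auto

lemma finite_blue_packed_forests: "finite (blue_packed_forests n)"
  unfolding blue_packed_forests_def
  by (rule finite_subset[OF _ finite_forests_of_finite_trees[OF finite_blue_packed_le[of n]]]) auto

end

theory Submission
  imports Defs "HOL-Library.List_Lexorder"
begin

text \<open>Dually, \<open>Prim\<close> is cut out by the equations "the coefficients of \<open>p\<close> sum to \<open>0\<close> over the
  shifted shuffle of \<open>u\<close> and \<open>v\<close>", and \<open>TPrim\<close> by their refinements to the words whose last letter
  comes from \<open>u\<close>, resp. from \<open>v\<close>. The lexicographically smallest words of these sets are \<open>u v'\<close> and,
  if the last letter comes from \<open>u\<close>, the word obtained by inserting \<open>v'\<close> in front of the last letter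
  of \<open>u\<close> (\<open>v'\<close> being \<open>v\<close> shifted by \<open>max u\<close>). By the dendriform identities it suffices to take
  irreducible, resp. totally irreducible, left factors \<open>u\<close>; these equations have distinct leading
  words, hence are triangular, and the dimensions of \<open>Prim\<close> and \<open>TPrim\<close> count the words that are not
  leading: the irreducible and the totally irreducible ones.

  A totally irreducible word other than \<open>1\<close> arises uniquely from an irreducible word by appending a
  letter, either an old value or a new one that is neither minimal nor maximal. Together with unique
  factorization for the two products this gives a bijection from blue-packed trees to irreducible
  words carrying size to length and weight to maximum.\<close>


section \<open>Packed words and shifted concatenation\<close>

lemma wmax_eq:
  assumes "set w = {1..m}"
  shows "wmax w = m"
  unfolding wmax_def assms by (rule Max_eqI) (simp, fastforce, cases m, simp_all)

lemma le_wmax: "a \<in> set w \<Longrightarrow> a \<le> wmax w"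
  by (simp add: wmax_def)

lemma packed_iff: "packed w \<longleftrightarrow> set w = {1..wmax w}"
  unfolding packed_def using le_wmax[of _ w] by (metis atLeastAtMost_iff subsetI subset_antisym)

lemma packedI: "set w = {1..m} \<Longrightarrow> packed w"
  using wmax_eq[of w m] packed_iff[of w] by simp

lemma packed_Nil [simp]: "packed []"
  by (simp add: packed_def wmax_def)

lemma wmax_Nil [simp]: "wmax [] = 0"
  by (simp add: wmax_def)

lemma wmax_pos: "packed w \<Longrightarrow> w \<noteq> [] \<Longrightarrow> 1 \<le> wmax w"
  unfolding packed_def by (metis last_in_set le_wmax order_trans)

lemma wmax_in_set: "packed w \<Longrightarrow> w \<noteq> [] \<Longrightarrow> wmax w \<in> set w"
  using wmax_pos[of w] packed_iff[of w] by (metis atLeastAtMost_iff order_refl)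

lemma packed_ge_1: "packed w \<Longrightarrow> a \<in> set w \<Longrightarrow> 1 \<le> a"
  unfolding packed_def by blast

lemma packed_mem: "packed w \<Longrightarrow> 1 \<le> i \<Longrightarrow> i \<le> wmax w \<Longrightarrow> i \<in> set w"
  unfolding packed_def by (meson atLeastAtMost_iff)

lemma packed_1: "packed [1]" "wmax [1] = 1"
  using packedI[of "[1]" 1] wmax_eq[of "[1]" 1] by simp_all

section \<open>The two shifted products on packed words\<close>

definition sconc :: "nat list \<Rightarrow> nat list \<Rightarrow> nat list" where
  "sconc u v = u @ map ((+) (wmax u)) v"

text \<open>The shifted \<open>v\<close> goes in front of the last letter of \<open>u\<close>. The
  word is meaningful for nonempty \<open>u\<close> only, since \<open>last []\<close> is
  unspecified.\<close>

definition pconc :: "nat list \<Rightarrow> nat list \<Rightarrow> nat list" where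
  "pconc u v = butlast u @ map ((+) (wmax u)) v @ [last u]"

lemma set_pconc: "u \<noteq> [] \<Longrightarrow> set (pconc u v) = set u \<union> (+) (wmax u) ` set v"
  unfolding pconc_def by (cases u rule: rev_cases) auto

lemma length_sconc [simp]: "length (sconc u v) = length u + length v"
  by (simp add: sconc_def)

lemma length_pconc [simp]: "u \<noteq> [] \<Longrightarrow> length (pconc u v) = length u + length v"
  by (simp add: pconc_def)

lemma packed_union_shift:
  assumes "packed u" "packed v"
  shows "set u \<union> (+) (wmax u) ` set v = {1..wmax u + wmax v}"
proof -
  have "{1..m} \<union> (+) m ` {1..k} = {1..m + k}" for m k :: nat
    by (auto simp: image_iff)
  then show ?thesis
    using assms packed_iff by metis
qed

lemma set_sconc_packed: "packed u \<Longrightarrow> packed v \<Longrightarrow> set (sconc u v) = {1..wmax u + wmax v}"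
  by (simp add: sconc_def packed_union_shift)

lemma set_pconc_packed:
  "packed u \<Longrightarrow> packed v \<Longrightarrow> u \<noteq> [] \<Longrightarrow> set (pconc u v) = {1..wmax u + wmax v}"
  by (simp add: set_pconc packed_union_shift)

lemma packed_sconc: "packed u \<Longrightarrow> packed v \<Longrightarrow> packed (sconc u v)"
  using set_sconc_packed packedI by metis

lemma wmax_sconc: "packed u \<Longrightarrow> packed v \<Longrightarrow> wmax (sconc u v) = wmax u + wmax v"
  using set_sconc_packed wmax_eq by metis

lemma packed_pconc: "packed u \<Longrightarrow> packed v \<Longrightarrow> u \<noteq> [] \<Longrightarrow> packed (pconc u v)"
  using set_pconc_packed packedI by metis

lemma wmax_pconc: "packed u \<Longrightarrow> packed v \<Longrightarrow> u \<noteq> [] \<Longrightarrow> wmax (pconc u v) = wmax u + wmax v"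
  using set_pconc_packed wmax_eq by metis

lemma sconc_Nil [simp]: "sconc [] v = v" "sconc u [] = u"
  by (auto simp: sconc_def intro: map_idI)

lemma pconc_Nil [simp]: "u \<noteq> [] \<Longrightarrow> pconc u [] = u"
  by (simp add: pconc_def)

lemma pconc_neq_Nil [simp]: "pconc u v \<noteq> []"
  by (simp add: pconc_def)

lemma last_pconc [simp]: "last (pconc u v) = last u"
  by (simp add: pconc_def)

lemma sconc_assoc:
  "packed u \<Longrightarrow> packed v \<Longrightarrow> sconc (sconc u v) w = sconc u (sconc v w)"
  using wmax_sconc[of u v] by (simp add: sconc_def comp_def add.assoc)

text \<open>Word-level shadow of the dendriform relation
  \<open>(a \<prec> b) \<prec> c = a \<prec> (b * c)\<close>; the next identity mirrors
  \<open>(a \<succ> b) \<prec> c = a \<succ> (b \<prec> c)\<close>.\<close>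

lemma pconc_pconc:
  "packed u \<Longrightarrow> packed v \<Longrightarrow> u \<noteq> [] \<Longrightarrow> pconc (pconc u v) w = pconc u (sconc v w)"
  using wmax_pconc[of u v] by (simp add: pconc_def sconc_def comp_def butlast_append add.assoc)

lemma pconc_sconc:
  "packed u \<Longrightarrow> packed v \<Longrightarrow> v \<noteq> [] \<Longrightarrow> pconc (sconc u v) w = sconc u (pconc v w)"
  using wmax_sconc[of u v]
  by (simp add: pconc_def sconc_def comp_def butlast_append map_butlast last_map add.assoc)

text \<open>An interval of values split into a lower and an upper part is split into two intervals,
  so \<open>u\<close> is packed and \<open>z\<close> is a shifted packed word. This turns the order
  conditions in \<open>decomp\<close> and \<open>pdecomp\<close> into factorizations.\<close>

lemma separated_packed:
  assumes s: "set u \<union> set z = {1..m}" and u: "set u \<noteq> {}" and lt: "\<forall>a\<in>set u. \<forall>b\<in>set z. a < b"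
  obtains v where "packed u" "packed v" "z = map ((+) (wmax u)) v"
proof -
  define k where "k = wmax u"
  have k: "k \<in> set u"
    using u Max_in[of "set u"] by (auto simp: k_def wmax_def)
  have le: "a \<le> k" if "a \<in> set u" for a
    using that le_wmax k_def by auto
  have mem: "a \<in> set u \<or> a \<in> set z \<longleftrightarrow> 1 \<le> a \<and> a \<le> m" for a
    using s by (metis Un_iff atLeastAtMost_iff)
  have gt: "k < b" if "b \<in> set z" for b
    using lt k that by blast
  have U: "a \<in> set u \<longleftrightarrow> 1 \<le> a \<and> a \<le> k" for a
    using mem[of a] mem[of k] k le[of a] gt[of a] by linarith
  have Z: "a \<in> set z \<longleftrightarrow> k + 1 \<le> a \<and> a \<le> m" for a
    using mem[of a] le[of a] gt[of a] by linarith
  define v where "v = map (\<lambda>a. a - k) z"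
  have zv: "z = map ((+) k) v"
    unfolding v_def map_map comp_def by (rule map_idI[symmetric]) (use Z in auto)
  have "b \<in> set v \<longleftrightarrow> 1 \<le> b \<and> b \<le> m - k" for b
  proof -
    have "b \<in> set v \<longleftrightarrow> k + b \<in> set z"
      unfolding zv by auto
    then show ?thesis
      unfolding Z by linarith
  qed
  then have "set v = {1..m - k}" "set u = {1..k}"
    using U by auto
  then show ?thesis
    using that[of v] packedI zv k_def by metis
qed

section \<open>Irreducible and totally irreducible words\<close>

text \<open>Phrased by comparing letters instead of by \<open>sconc\<close>, so that it also applies
  to words that are not packed, such as what remains after deleting a last letter, and is invariant
  under increasing relabellings.\<close>

definition decomp :: "nat list \<Rightarrow> bool" where
  "decomp w \<longleftrightarrow> (\<exists>x y. w = x @ y \<and> x \<noteq> [] \<and> y \<noteq> [] \<and> (\<forall>a\<in>set x. \<forall>b\<in>set y. a < b))"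

text \<open>An empty \<open>x\<close> is allowed: the left factor is then the single letter
  \<open>l\<close>.\<close>

definition pdecomp :: "nat list \<Rightarrow> bool" where
  "pdecomp w \<longleftrightarrow>
     (\<exists>x y l. w = x @ y @ [l] \<and> y \<noteq> [] \<and> (\<forall>a\<in>insert l (set x). \<forall>b\<in>set y. a < b))"

definition irr :: "nat list \<Rightarrow> bool" where
  "irr w \<longleftrightarrow> packed w \<and> w \<noteq> [] \<and> \<not> decomp w"

definition tirr :: "nat list \<Rightarrow> bool" where
  "tirr w \<longleftrightarrow> irr w \<and> \<not> pdecomp w"

lemma decomp_sconc:
  assumes "u \<noteq> []" "v \<noteq> []" "packed v"
  shows "decomp (sconc u v)"
  unfolding decomp_def sconc_def
  by (rule exI[of _ u], rule exI[of _ "map ((+) (wmax u)) v"])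
     (use assms le_wmax packed_ge_1 in \<open>fastforce simp: Suc_le_eq\<close>)

lemma pdecomp_pconc:
  assumes "u \<noteq> []" "v \<noteq> []" "packed v"
  shows "pdecomp (pconc u v)"
proof -
  have "a \<le> wmax u" if "a \<in> insert (last u) (set (butlast u))" for a
    using that assms in_set_butlastD le_wmax by (metis insertE last_in_set)
  then show ?thesis
    unfolding pdecomp_def pconc_def
    by (intro exI[of _ "butlast u"] exI[of _ "map ((+) (wmax u)) v"] exI[of _ "last u"])
       (use assms packed_ge_1 in \<open>fastforce simp: Suc_le_eq\<close>)
qed

lemma decompE:
  assumes "decomp w" "packed w"
  obtains u v where "packed u" "packed v" "u \<noteq> []" "v \<noteq> []" "w = sconc u v"
proof -
  obtain x y where xy: "w = x @ y" "x \<noteq> []" "y \<noteq> []" "\<forall>a\<in>set x. \<forall>b\<in>set y. a < b"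
    using assms decomp_def by blast
  have "set x \<union> set y = {1..wmax w}"
    using assms(2) xy(1) packed_iff[of w] by auto
  then obtain v where "packed x" "packed v" "y = map ((+) (wmax x)) v"
    using xy separated_packed by (metis set_empty)
  then show ?thesis
    using that[of x v] xy by (auto simp: sconc_def)
qed

lemma pdecompE:
  assumes "pdecomp w" "packed w"
  obtains u v where "packed u" "packed v" "u \<noteq> []" "v \<noteq> []" "w = pconc u v"
proof -
  obtain x y l where xy: "w = x @ y @ [l]" "y \<noteq> []" "\<forall>a\<in>insert l (set x). \<forall>b\<in>set y. a < b"
    using assms pdecomp_def by blast
  have 1: "set (x @ [l]) \<union> set y = {1..wmax w}"
    using assms(2) xy(1) packed_iff[of w] by auto
  have 2: "set (x @ [l]) \<noteq> {}"
    by simp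
  have 3: "\<forall>a\<in>set (x @ [l]). \<forall>b\<in>set y. a < b"
    using xy by auto
  obtain v where "packed (x @ [l])" "packed v" "y = map ((+) (wmax (x @ [l]))) v"
    using separated_packed[OF 1 2 3] by blast
  then show ?thesis
    using that[of "x @ [l]" v] xy by (auto simp: pconc_def)
qed

section \<open>Uniqueness of the left factors\<close>

lemma map_add_inj: "map ((+) (m::nat)) v = map ((+) m) v' \<Longrightarrow> v = v'"
  by (rule map_injective) (auto intro: injI)

text \<open>A longer \<open>u'\<close> would be \<open>u\<close> followed by a nonempty piece of the
  shifted \<open>v\<close>. That piece lies above \<open>u\<close>, so \<open>u'\<close> would
  decompose.\<close>

lemma sconc_irr_unique_aux:
  assumes "irr u" "irr u'" "packed v" "packed v'" "sconc u v = sconc u' v'"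
  shows "length u' \<le> length u"
proof (rule ccontr)
  assume "\<not> length u' \<le> length u"
  then obtain z where z: "u' = u @ z" "z \<noteq> []" "\<exists>z'. map ((+) (wmax u)) v = z @ z'"
    using assms(5) unfolding sconc_def append_eq_append_conv2 by auto
  then obtain z' where z': "map ((+) (wmax u)) v = z @ z'" by blast
  have "set z \<subseteq> set (map ((+) (wmax u)) v)"
    unfolding z' by auto
  then have "\<forall>a\<in>set u. \<forall>b\<in>set z. a < b"
    using le_wmax[of _ u] packed_ge_1[OF assms(3)] by (fastforce simp: Suc_le_eq)
  then have "decomp u'"
    unfolding decomp_def using z assms(1) by (auto simp: irr_def)
  then show False
    using assms(2) by (simp add: irr_def)
qed

lemma sconc_irr_unique:
  assumes "irr u" "irr u'" "packed v" "packed v'" "sconc u v = sconc u' v'"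
  shows "u = u' \<and> v = v'"
proof -
  have "length u = length u'"
    using sconc_irr_unique_aux assms by (metis le_antisym)
  then show ?thesis
    using assms(5) map_add_inj unfolding sconc_def by auto
qed

text \<open>Both words end in the same letter. After deleting it, a longer \<open>u'\<close> turns
  out to be \<open>u\<close> with a nonempty piece of the shifted \<open>v\<close> inserted before
  the last letter, against total irreducibility.\<close>

lemma pconc_tirr_unique_aux:
  assumes "tirr u" "tirr u'" "packed v" "packed v'" "pconc u v = pconc u' v'"
  shows "length u' \<le> length u"
proof (rule ccontr)
  assume "\<not> length u' \<le> length u"
  then have len: "length u < length u'" by simp
  have ne: "u \<noteq> []" "u' \<noteq> []"
    using assms by (auto simp: tirr_def irr_def)
  have eq: "butlast u @ map ((+) (wmax u)) v = butlast u' @ map ((+) (wmax u')) v'"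
    and last: "last u = last u'"
    using assms(5) unfolding pconc_def by (metis append_assoc append1_eq_conv)+
  have len': "length (butlast u) < length (butlast u')"
    using len ne by (cases u) auto
  obtain z where "butlast u = butlast u' @ z \<or>
      butlast u @ z = butlast u' \<and> map ((+) (wmax u)) v = z @ map ((+) (wmax u')) v'"
    using eq unfolding append_eq_append_conv2 by blast
  then have z: "butlast u' = butlast u @ z" "z \<noteq> []"
    "map ((+) (wmax u)) v = z @ map ((+) (wmax u')) v'"
    using len' by (metis length_append less_iff_Suc_add not_add_less1 append_Nil2 less_irrefl)+
  have "set z \<subseteq> set (map ((+) (wmax u)) v)"
    unfolding z by auto
  then have "\<forall>a\<in>set u. \<forall>b\<in>set z. a < b"
    using le_wmax[of _ u] packed_ge_1[OF assms(3)] by (fastforce simp: Suc_le_eq)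
  then have "\<forall>a\<in>insert (last u) (set (butlast u)). \<forall>b\<in>set z. a < b"
    using ne(1) by (auto dest: in_set_butlastD)
  moreover have "u' = butlast u @ z @ [last u]"
    using z last ne(2) by (metis append_assoc append_butlast_last_id)
  ultimately have "pdecomp u'"
    unfolding pdecomp_def using z by blast
  then show False
    using assms(2) by (simp add: tirr_def)
qed

lemma pconc_tirr_unique:
  assumes "tirr u" "tirr u'" "packed v" "packed v'" "pconc u v = pconc u' v'"
  shows "u = u' \<and> v = v'"
proof -
  have ne: "u \<noteq> []" "u' \<noteq> []"
    using assms by (auto simp: tirr_def irr_def)
  have len: "length u = length u'"
    using pconc_tirr_unique_aux assms by (metis le_antisym)
  have "butlast u = butlast u'" "map ((+) (wmax u)) v = map ((+) (wmax u')) v'" "last u = last u'"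
    using assms(5) len unfolding pconc_def by auto
  then show ?thesis
    using ne map_add_inj append_butlast_last_id by metis
qed

section \<open>Existence of the factorizations\<close>

lemma sconc_irr_exists:
  assumes "packed w" "w \<noteq> []"
  obtains u v where "irr u" "packed v" "w = sconc u v"
proof -
  have "\<exists>u v. irr u \<and> packed v \<and> w = sconc u v"
    using assms
  proof (induction "length w" arbitrary: w rule: less_induct)
    case less
    show ?case
    proof (cases "decomp w")
      case True
      then obtain a b where ab: "packed a" "packed b" "a \<noteq> []" "b \<noteq> []" "w = sconc a b"
        using less.prems decompE by metis
      then obtain u v where uv: "irr u" "packed v" "a = sconc u v"
        using less.hyps[of a] by auto
      \<comment> \<open>Associativity moves the rest of \<open>a\<close> into the right
        factor.\<close>
      then have "w = sconc u (sconc v b)"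
        using ab sconc_assoc by (auto simp: irr_def)
      then show ?thesis
        using uv ab packed_sconc by blast
    next
      case False
      then show ?thesis
        using less.prems by (intro exI[of _ w] exI[of _ "[]"]) (auto simp: irr_def)
    qed
  qed
  then show ?thesis using that by blast
qed

text \<open>A factorization of \<open>u\<close> survives the insertion of \<open>v\<close>, because
  \<open>pconc (sconc a b) v = sconc a (pconc b v)\<close>.\<close>

lemma irr_pconc_left:
  assumes "irr (pconc u v)" "packed u" "packed v" "u \<noteq> []"
  shows "irr u"
proof -
  have "\<not> decomp u"
  proof
    assume "decomp u"
    then obtain a b where ab: "packed a" "packed b" "a \<noteq> []" "b \<noteq> []" "u = sconc a b"
      using assms decompE by metis
    then have "pconc u v = sconc a (pconc b v)"
      by (simp add: pconc_sconc)
    then have "decomp (pconc u v)"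
      using ab assms decomp_sconc packed_pconc by auto
    then show False
      using assms by (simp add: irr_def)
  qed
  then show ?thesis
    using assms by (simp add: irr_def)
qed

text \<open>In a cut of \<open>pconc u v\<close> the letter \<open>last u\<close> lies on the right,
  so the left part stays below it. The left part thus contains no letter of the shifted
  \<open>v\<close>, and the cut restricts to one of \<open>u\<close>.\<close>

lemma irr_pconc:
  assumes u: "irr u" and v: "packed v"
  shows "irr (pconc u v)"
proof -
  have ne: "u \<noteq> []" and pu: "packed u" using u by (auto simp: irr_def)
  have "\<not> decomp (pconc u v)"
  proof
    assume "decomp (pconc u v)"
    then obtain x y where xy: "pconc u v = x @ y" "x \<noteq> []" "y \<noteq> []" "\<forall>a\<in>set x. \<forall>b\<in>set y. a < b"
      using decomp_def by blast
    define y' where "y' = butlast y"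
    have y: "y = y' @ [last u]"
      using xy(1,3) last_pconc[of u v] append_butlast_last_id[of y] by (simp add: y'_def)
    have eq: "butlast u @ map ((+) (wmax u)) v = x @ y'"
      using xy(1) y unfolding pconc_def by simp
    have lu: "last u \<le> wmax u" using ne le_wmax by simp
    have lx: "a < last u" if "a \<in> set x" for a using xy(4) y that by auto
    obtain z where z: "butlast u = x @ z" "y' = z @ map ((+) (wmax u)) v"
    proof -
      consider z where "butlast u = x @ z" "y' = z @ map ((+) (wmax u)) v"
        | z where "x = butlast u @ z" "map ((+) (wmax u)) v = z @ y'"
        using eq unfolding append_eq_append_conv2 by metis
      then show ?thesis
      proof cases
        case 2
        \<comment> \<open>A letter of \<open>z\<close> would be at least \<open>wmax u\<close>,
          coming from the shifted \<open>v\<close>, and below \<open>last u\<close>, lying in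
          \<open>x\<close>.\<close>
        have "z = []"
        proof (rule ccontr)
          assume "z \<noteq> []"
          then have "hd z \<in> set z" by simp
          moreover have "hd z \<in> (+) (wmax u) ` set v"
            using \<open>hd z \<in> set z\<close> 2(2) by (metis Un_iff list.set_map set_append)
          ultimately show False using lx[of "hd z"] lu 2 by auto
        qed
        then show ?thesis using that[of "[]"] 2 by auto
      qed (use that in blast)
    qed
    have "u = x @ (z @ [last u])"
      using z ne by (metis append_assoc append_butlast_last_id)
    moreover have "\<forall>a\<in>set x. \<forall>b\<in>set (z @ [last u]). a < b"
      using xy(4) y z by auto
    ultimately have "decomp u" unfolding decomp_def using xy(2) by blast
    then show False using u by (simp add: irr_def)
  qed
  then show ?thesis
    using packed_pconc[OF pu v ne] by (simp add: irr_def)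
qed

text \<open>The left factor of an irreducible \<open>pconc\<close> is again irreducible, so
  induction on the length applies to it; \<open>pconc_pconc\<close> collects the right factors into
  one.\<close>

lemma pconc_tirr_exists:
  assumes "irr w"
  obtains u v where "tirr u" "packed v" "w = pconc u v"
proof -
  have "\<exists>u v. tirr u \<and> packed v \<and> w = pconc u v"
    using assms
  proof (induction "length w" arbitrary: w rule: less_induct)
    case less
    show ?case
    proof (cases "pdecomp w")
      case True
      then obtain a b where ab: "packed a" "packed b" "a \<noteq> []" "b \<noteq> []" "w = pconc a b"
        using less.prems pdecompE unfolding irr_def by metis
      then have "irr a" using irr_pconc_left less.prems by blast
      then obtain u v where uv: "tirr u" "packed v" "a = pconc u v"
        using less.hyps[of a] ab by auto
      then have "w = pconc u (sconc v b)"
        using ab pconc_pconc by (auto simp: irr_def tirr_def)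
      then show ?thesis
        using uv ab packed_sconc by blast
    next
      case False
      then show ?thesis
        using less.prems by (intro exI[of _ w] exI[of _ "[]"]) (auto simp: irr_def tirr_def)
    qed
  qed
  then show ?thesis using that by blast
qed

section \<open>Inserting a last letter\<close>

text \<open>For \<open>\<alpha> = Circ\<close> the appended letter \<open>i\<close> is a new value, inserted just below the
  previous value \<open>i\<close>.\<close>

definition bump :: "nat \<Rightarrow> nat \<Rightarrow> nat" where
  "bump i a = (if i \<le> a then a + 1 else a)"

definition insert_last :: "nat list \<Rightarrow> nat \<Rightarrow> mark \<Rightarrow> nat list" where
  "insert_last x i \<alpha> = (if \<alpha> = Circ then map (bump i) x else x) @ [i]"

lemma bump_less_iff [simp]: "bump i a < bump i b \<longleftrightarrow> a < b"
  by (auto simp: bump_def)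

lemma decomp_map_bump: "decomp (map (bump i) x) \<longleftrightarrow> decomp x"
proof
  assume "decomp x"
  then obtain a b where "x = a @ b" "a \<noteq> []" "b \<noteq> []" "\<forall>c\<in>set a. \<forall>d\<in>set b. c < d"
    unfolding decomp_def by blast
  then show "decomp (map (bump i) x)"
    unfolding decomp_def by (intro exI[of _ "map (bump i) a"] exI[of _ "map (bump i) b"]) auto
next
  assume "decomp (map (bump i) x)"
  then obtain a b where ab: "map (bump i) x = a @ b" "a \<noteq> []" "b \<noteq> []"
    "\<forall>c\<in>set a. \<forall>d\<in>set b. c < d"
    unfolding decomp_def by blast
  then obtain a' b' where "x = a' @ b'" "a = map (bump i) a'" "b = map (bump i) b'"
    by (auto simp: map_eq_append_conv)
  then show "decomp x"
    unfolding decomp_def using ab by (intro exI[of _ a'] exI[of _ b']) auto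
qed

lemma length_insert_last [simp]: "length (insert_last x i \<alpha>) = Suc (length x)"
  by (simp add: insert_last_def)

lemma insert_bump_interval:
  assumes "1 \<le> i" "i \<le> m + 1"
  shows "insert i (bump i ` {1..m}) = {1..m + 1}"
proof -
  have "a \<in> insert i (bump i ` {1..m})" if a: "a \<in> {1..m + 1}" for a
  proof -
    consider "a < i" | "a = i" | "i < a" by linarith
    then show ?thesis
    proof cases
      case 1
      then have "a = bump i a" "a \<in> {1..m}" using a assms by (auto simp: bump_def)
      then show ?thesis by blast
    next
      case 3
      then have "a = bump i (a - 1)" "a - 1 \<in> {1..m}" using a assms by (auto simp: bump_def)
      then show ?thesis by blast
    qed simp
  qed
  moreover have "bump i a \<in> {1..m + 1}" if "a \<in> {1..m}" for a
    using that by (auto simp: bump_def)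
  ultimately show ?thesis
    using assms by fastforce
qed

lemma set_insert_last:
  assumes "packed x" "1 \<le> i" "i \<le> wmax x"
  shows "set (insert_last x i \<alpha>) = {1..wmax x + (if \<alpha> = Circ then 1 else 0)}"
proof -
  have "set x = {1..wmax x}"
    using assms packed_iff by blast
  then have "set (insert_last x i \<alpha>) =
      (if \<alpha> = Circ then insert i (bump i ` {1..wmax x}) else insert i {1..wmax x})"
    unfolding insert_last_def by (simp split: if_split)
  also have "\<dots> = {1..wmax x + (if \<alpha> = Circ then 1 else 0)}"
    using insert_bump_interval[of i "wmax x"] assms by (simp add: insert_absorb)
  finally show ?thesis .
qed

lemma packed_insert_last:
  assumes "packed x" "1 \<le> i" "i \<le> wmax x"
  shows "packed (insert_last x i \<alpha>)"
  using set_insert_last[OF assms] packedI by blast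

lemma wmax_insert_last:
  assumes "packed x" "1 \<le> i" "i \<le> wmax x"
  shows "wmax (insert_last x i \<alpha>) = wmax x + (if \<alpha> = Circ then 1 else 0)"
  using set_insert_last[OF assms] wmax_eq by blast

text \<open>A cut of \<open>y @ [i]\<close> that does not cut \<open>y\<close> would put
  \<open>i\<close> above all of \<open>y\<close>, or, for \<open>pdecomp\<close>, below all of
  \<open>y\<close>. Letters of \<open>y\<close> on both sides of \<open>i\<close>, in the weak
  sense, exclude this.\<close>

lemma tirr_insert_last:
  assumes x: "irr x" and i: "1 \<le> i" "i \<le> wmax x" and ne: "(i, \<alpha>) \<noteq> (1, Circ)"
  shows "tirr (insert_last x i \<alpha>)"
proof -
  define y where "y = (if \<alpha> = Circ then map (bump i) x else x)"
  have w: "insert_last x i \<alpha> = y @ [i]"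
    by (simp add: insert_last_def y_def)
  have px: "packed x" and xne: "x \<noteq> []" using x by (auto simp: irr_def)
  have y: "\<not> decomp y"
    using x decomp_map_bump by (auto simp: y_def irr_def)
  have big: "\<exists>b\<in>set y. i \<le> b"
    using wmax_in_set[OF px xne] i(2)
    by (intro bexI[of _ "if \<alpha> = Circ then bump i (wmax x) else wmax x"])
       (auto simp: y_def bump_def)
  have 1: "1 \<in> set x"
    using packed_mem[OF px] wmax_pos[OF px xne] by blast
  \<comment> \<open>For \<open>Circ\<close> the excluded label forces \<open>i > 1\<close>, hence
    the letter 1 is not bumped and stays below \<open>i\<close>.\<close>
  have small: "\<exists>a\<in>set y. a \<le> i"
  proof (cases "\<alpha> = Circ")
    case True
    then have "bump i 1 \<le> i" using ne i(1) by (simp add: bump_def)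
    then show ?thesis using 1 True unfolding y_def by auto
  next
    case False
    then show ?thesis using 1 i(1) unfolding y_def by auto
  qed
  have "\<not> decomp (y @ [i])"
  proof
    assume "decomp (y @ [i])"
    then obtain a b where ab: "y @ [i] = a @ b" "a \<noteq> []" "b \<noteq> []" "\<forall>c\<in>set a. \<forall>d\<in>set b. c < d"
      unfolding decomp_def by blast
    obtain b' where b': "b = b' @ [i]" "y = a @ b'"
      using ab(1,3) by (metis append_assoc append_butlast_last_id append1_eq_conv)
    have "b' \<noteq> []"
      using big ab(4) b' by fastforce
    then show False
      using y ab(2,4) b' unfolding decomp_def by (metis Un_iff set_append)
  qed
  moreover have "\<not> pdecomp (y @ [i])"
  proof
    assume "pdecomp (y @ [i])"
    then obtain a b where ab: "y = a @ b" "b \<noteq> []" "\<forall>c\<in>insert i (set a). \<forall>d\<in>set b. c < d"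
      unfolding pdecomp_def by auto
    then have "a \<noteq> []"
      using small by fastforce
    then show False
      using y ab unfolding decomp_def by (metis insertCI)
  qed
  ultimately show ?thesis
    using packed_insert_last[OF px i, of \<alpha>] unfolding w tirr_def irr_def by simp
qed

text \<open>The mark can be read off: for \<open>Bullet\<close> the last letter also occurs earlier,
  for \<open>Circ\<close> it does not, since \<open>bump i\<close> omits the value
  \<open>i\<close>.\<close>

lemma insert_last_inj:
  assumes "packed x" "packed x'" "1 \<le> i" "i \<le> wmax x" "i' \<le> wmax x'"
    and eq: "insert_last x i \<alpha> = insert_last x' i' \<alpha>'"
  shows "x = x' \<and> i = i' \<and> \<alpha> = \<alpha>'"
proof -
  have i: "i = i'" and
    y: "(if \<alpha> = Circ then map (bump i) x else x) = (if \<alpha>' = Circ then map (bump i) x' else x')"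
    using eq unfolding insert_last_def by auto
  have ix: "i \<in> set x" "i \<in> set x'"
    using assms i packed_mem by metis+
  have nb: "i \<notin> set (map (bump i) z)" for z
    by (auto simp: bump_def split: if_splits)
  have inj: "map (bump i) x = map (bump i) x' \<Longrightarrow> x = x'"
    by (rule map_injective) (auto intro!: injI simp: bump_def split: if_splits)
  have "\<alpha> = \<alpha>'"
    using y ix nb by (metis (full_types) mark.exhaust)
  then show ?thesis
    using y inj i by (auto split: if_splits)
qed

text \<open>Deleting the last letter \<open>i\<close> leaves an indecomposable \<open>y\<close>: a
  cut of \<open>y\<close> extends to \<open>w\<close>, with \<open>i\<close> playing the last letter
  of a \<open>pdecomp\<close> or joining the right part of a \<open>decomp\<close>. If
  \<open>i\<close> still occurs in \<open>y\<close> the mark is \<open>Bullet\<close>; otherwise the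
  gap at \<open>i\<close> is closed and the mark is \<open>Circ\<close>.\<close>

lemma tirr_insert_last_exists:
  assumes w: "tirr w" and len: "2 \<le> length w"
  obtains x i \<alpha> where "irr x" "1 \<le> i" "i \<le> wmax x" "(i, \<alpha>) \<noteq> (1, Circ)" "w = insert_last x i \<alpha>"
proof -
  have pw: "packed w" and nd: "\<not> decomp w" and npd: "\<not> pdecomp w"
    using w by (auto simp: tirr_def irr_def)
  obtain y i where yi: "w = y @ [i]" and yne: "y \<noteq> []"
    using len that by (cases w rule: rev_cases) fastforce+
  have S: "a \<in> set y \<or> a = i \<longleftrightarrow> 1 \<le> a \<and> a \<le> wmax w" for a
    using packed_iff[of w] pw yi by (metis Un_iff atLeastAtMost_iff empty_iff insert_iff
        list.simps(15) set_append set_empty2)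
  have i1: "1 \<le> i" "i \<le> wmax w" using S by blast+
  have ndy: "\<not> decomp y"
  proof
    assume "decomp y"
    then obtain a b where ab: "y = a @ b" "a \<noteq> []" "b \<noteq> []" "\<forall>c\<in>set a. \<forall>d\<in>set b. c < d"
      unfolding decomp_def by blast
    show False
    proof (cases "\<forall>d\<in>set b. i < d")
      case True
      then have "pdecomp w"
        unfolding pdecomp_def using ab yi by (intro exI[of _ a] exI[of _ b] exI[of _ i]) auto
      then show ?thesis using npd by simp
    next
      case False
      \<comment> \<open>Some letter of \<open>b\<close> is at most \<open>i\<close>, and it exceeds
        all of \<open>a\<close>.\<close>
      then have "\<forall>c\<in>set a. c < i" using ab(4) by (meson linorder_not_less order_less_le_trans)
      then have "decomp w"
        unfolding decomp_def using ab yi by (intro exI[of _ a] exI[of _ "b @ [i]"]) auto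
      then show ?thesis using nd by simp
    qed
  qed
  show ?thesis
  proof (cases "i \<in> set y")
    case True
    have "a \<in> set y \<longleftrightarrow> 1 \<le> a \<and> a \<le> wmax w" for a
      using S[of a] True by metis
    then have sy: "set y = {1..wmax w}" by (simp add: set_eq_iff)
    then have "packed y" "wmax y = wmax w" using packedI wmax_eq by blast+
    then show ?thesis
      using that[of y i Bullet] ndy yne i1 yi by (simp add: irr_def insert_last_def)
  next
    case False
    define m where "m = wmax w"
    have S': "a \<in> set y \<longleftrightarrow> 1 \<le> a \<and> a \<le> m \<and> a \<noteq> i" for a
      using S[of a] False unfolding m_def by metis
    define x where "x = map (\<lambda>a. if a > i then a - 1 else a) y"
    have yx: "y = map (bump i) x"
      unfolding x_def map_map comp_def
      by (rule map_idI[symmetric]) (use False in \<open>auto simp: bump_def\<close>)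
    have "b \<in> set x \<longleftrightarrow> 1 \<le> b \<and> b \<le> m - 1" for b
    proof -
      have "inj (bump i)"
        by (auto intro!: injI simp: bump_def split: if_splits)
      then have "b \<in> set x \<longleftrightarrow> bump i b \<in> set y"
        unfolding yx by (simp add: inj_image_mem_iff)
      then show ?thesis
        unfolding S' using i1 by (auto simp: bump_def m_def)
    qed
    then have "set x = {1..m - 1}" by (simp add: set_eq_iff)
    then have px: "packed x" "wmax x = m - 1" using packedI wmax_eq by blast+
    have irx: "irr x"
      using px ndy yne decomp_map_bump[of i x] yx unfolding irr_def by auto
    \<comment> \<open>A new value must be neither minimal nor maximal in \<open>w\<close>: the
      minimum would give a \<open>pdecomp\<close> with empty \<open>x\<close>, the maximum a
      \<open>decomp\<close>. What remains is \<open>i \<le> m - 1 = wmax x\<close> and a label other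
      than \<open>(1, Circ)\<close>.\<close>
    have "i \<noteq> 1"
    proof
      assume "i = 1"
      then have "\<forall>d\<in>set y. i < d"
        using S' by (metis le_neq_implies_less)
      then have "pdecomp w"
        unfolding pdecomp_def using yi yne
        by (intro exI[of _ "[]"] exI[of _ y] exI[of _ i]) simp
      then show False using npd by simp
    qed
    moreover have "i \<noteq> m"
    proof
      assume "i = m"
      then have "\<forall>c\<in>set y. c < i"
        using S' by (metis le_neq_implies_less)
      then have "decomp w"
        unfolding decomp_def using yi yne
        by (intro exI[of _ y] exI[of _ "[i]"]) simp
      then show False using nd by simp
    qed
    moreover have "w = insert_last x i Circ"
      using yi yx by (simp add: insert_last_def)
    ultimately show ?thesis
      using that[OF irx, of i Circ] i1 px m_def by simp
  qed
qed

section \<open>The words of blue-packed trees and forests\<close>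

definition forest_concat :: "nat list list \<Rightarrow> nat list" where
  "forest_concat ws = foldr sconc ws []"

fun root_word :: "blue_label \<Rightarrow> nat list list \<Rightarrow> nat list" where
  "root_word (i, \<alpha>) [] = [1]"
| "root_word (i, \<alpha>) (r # rs) = insert_last r i \<alpha>"

text \<open>Mirrors the factorization by \<open>pconc\<close>: the root with its right forest
  encodes the totally irreducible factor, the left forest the inserted packed word.\<close>

fun tree_word :: "blue_label biplane_tree \<Rightarrow> nat list" where
  "tree_word (Node x fl fr) =
     pconc (root_word x (map tree_word fr)) (forest_concat (map tree_word fl))"

definition forest_word :: "blue_label biplane_tree list \<Rightarrow> nat list" where
  "forest_word f = forest_concat (map tree_word f)"

lemma forest_word_simps [simp]:
  "forest_word [] = []" "forest_word (t # f) = sconc (tree_word t) (forest_word f)"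
  by (simp_all add: forest_word_def forest_concat_def)

lemma tree_word_Node:
  "tree_word (Node x fl fr) = pconc (root_word x (map tree_word fr)) (forest_word fl)"
  by (simp add: forest_word_def)

lemma tirr_1: "tirr [1]"
proof -
  have "\<not> decomp [1]" "\<not> pdecomp [1]"
    unfolding decomp_def pdecomp_def by (auto simp: Cons_eq_append_conv)
  then show ?thesis
    using packed_1 by (simp add: tirr_def irr_def)
qed

text \<open>The invariant of the induction over trees. Matching \<open>weight\<close> with
  \<open>wmax\<close> turns the label bound \<open>i \<le> weight r\<close> into the bound on the
  appended letter in \<open>insert_last\<close>.\<close>

definition word_of_tree :: "blue_label biplane_tree \<Rightarrow> nat list \<Rightarrow> bool" where
  "word_of_tree t w \<longleftrightarrow> irr w \<and> length w = tree_size t \<and> wmax w = weight t"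

lemma forest_word_stats:
  assumes "\<And>t. t \<in> set f \<Longrightarrow> word_of_tree t (tree_word t)"
  shows "packed (forest_word f) \<and> length (forest_word f) = sum_list (map tree_size f) \<and>
    wmax (forest_word f) = sum_list (map weight f)"
  using assms
proof (induction f)
  case (Cons t f)
  have "word_of_tree t (tree_word t)"
    using Cons.prems by simp
  moreover have "packed (forest_word f) \<and> length (forest_word f) = sum_list (map tree_size f) \<and>
    wmax (forest_word f) = sum_list (map weight f)"
    using Cons by simp
  ultimately show ?case
    by (simp add: packed_sconc wmax_sconc word_of_tree_def irr_def)
qed simp

lemma root_word_stats:
  assumes bp: "blue_packed (Node (i, \<alpha>) fl fr)"
    and IH: "\<And>t. t \<in> set fr \<Longrightarrow> word_of_tree t (tree_word t)"
  shows "tirr (root_word (i, \<alpha>) (map tree_word fr)) \<and>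
    length (root_word (i, \<alpha>) (map tree_word fr)) = 1 + sum_list (map tree_size fr) \<and>
    wmax (root_word (i, \<alpha>) (map tree_word fr)) =
      (if \<alpha> = Circ then 1 else 0) + sum_list (map weight fr)"
proof (cases fr)
  case Nil
  then show ?thesis using bp tirr_1 packed_1 by simp
next
  case (Cons r rs)
  then have r: "fr = [r]" "(i, \<alpha>) \<noteq> (1, Circ)" "1 \<le> i" "i \<le> weight r"
    using bp by auto
  have "word_of_tree r (tree_word r)" using IH r by simp
  then show ?thesis
    using r tirr_insert_last[of "tree_word r" i \<alpha>] wmax_insert_last[of "tree_word r" i \<alpha>]
    by (simp add: word_of_tree_def irr_def)
qed

lemma tirr_packed: "tirr w \<Longrightarrow> packed w" "tirr w \<Longrightarrow> w \<noteq> []" "tirr w \<Longrightarrow> irr w"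
  by (auto simp: tirr_def irr_def)

lemma tree_word_stats: "blue_packed t \<Longrightarrow> word_of_tree t (tree_word t)"
proof (induction t)
  case (Node x fl fr)
  obtain i \<alpha> where x: "x = (i, \<alpha>)" by force
  have l: "word_of_tree t (tree_word t)" if "t \<in> set fl" for t
    using Node that x by auto
  have r: "word_of_tree t (tree_word t)" if "t \<in> set fr" for t
    using Node that x by auto
  note L = forest_word_stats[of fl, OF l]
  note R = root_word_stats[OF Node.prems[unfolded x] r]
  have "irr (root_word x (map tree_word fr))" "packed (root_word x (map tree_word fr))"
     "root_word x (map tree_word fr) \<noteq> []"
    using R x tirr_packed by blast+
  then show ?case
    using L R x irr_pconc wmax_pconc
    unfolding word_of_tree_def tree_word_Node by simp
qed

lemma irr_tree_word: "blue_packed t \<Longrightarrow> irr (tree_word t)"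
  using tree_word_stats word_of_tree_def by blast

lemma packed_forest_word: "\<forall>t\<in>set f. blue_packed t \<Longrightarrow> packed (forest_word f)"
  using forest_word_stats tree_word_stats by blast

lemma length_forest_word: "\<forall>t\<in>set f. blue_packed t \<Longrightarrow> length (forest_word f) = forest_size f"
  using forest_word_stats tree_word_stats forest_size_def by metis

lemma tirr_root_word:
  assumes "blue_packed (Node x fl fr)"
  shows "tirr (root_word x (map tree_word fr))"
proof -
  obtain i \<alpha> where x: "x = (i, \<alpha>)" by force
  have "word_of_tree t (tree_word t)" if "t \<in> set fr" for t
    using assms that tree_word_stats unfolding x by simp
  then show ?thesis
    using root_word_stats assms unfolding x by blast
qed

section \<open>Injectivity of the word maps\<close>

lemma forest_word_eq_Nil_iff: "\<forall>t\<in>set f. blue_packed t \<Longrightarrow> forest_word f = [] \<longleftrightarrow> f = []"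
  using irr_tree_word by (cases f) (auto simp: irr_def sconc_def)

text \<open>Injectivity of \<open>tree_word\<close> is assumed at the members of \<open>f\<close>
  only, which is what the induction over trees provides. The trees are read off from the left by
  unique factorization.\<close>

lemma forest_word_inj:
  assumes "\<And>t t'. t \<in> set f \<Longrightarrow> blue_packed t' \<Longrightarrow> tree_word t = tree_word t' \<Longrightarrow> t = t'"
    and "\<forall>t\<in>set f. blue_packed t" "\<forall>t\<in>set f'. blue_packed t" "forest_word f = forest_word f'"
  shows "f = f'"
  using assms
proof (induction f arbitrary: f')
  case Nil
  then show ?case using forest_word_eq_Nil_iff by (metis forest_word_simps(1))
next
  case (Cons t f)
  then obtain t' g where f': "f' = t' # g"
    using forest_word_eq_Nil_iff by (metis list.distinct(1) neq_Nil_conv)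
  have "tree_word t = tree_word t' \<and> forest_word f = forest_word g"
    by (rule sconc_irr_unique) (use Cons.prems f' irr_tree_word packed_forest_word in auto)
  then show ?case
    using Cons.prems Cons.IH[of g] f' by simp
qed

lemma root_word_inj:
  assumes "\<And>t t'. t \<in> set fr \<Longrightarrow> blue_packed t' \<Longrightarrow> tree_word t = tree_word t' \<Longrightarrow> t = t'"
    and bp: "blue_packed (Node x fl fr)" and bp': "blue_packed (Node x' fl' fr')"
    and eq: "root_word x (map tree_word fr) = root_word x' (map tree_word fr')"
  shows "x = x' \<and> fr = fr'"
proof -
  obtain i \<alpha> i' \<alpha>' where x: "x = (i, \<alpha>)" "x' = (i', \<alpha>')" by force
  have st: "irr (tree_word t)" "wmax (tree_word t) = weight t" "tree_word t \<noteq> []" 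
    "packed (tree_word t)" if "blue_packed t" for t
    using tree_word_stats[OF that] by (auto simp: word_of_tree_def irr_def)
  show ?thesis
  proof (cases fr)
    case Nil
    then have "root_word x' (map tree_word fr') = [1]"
      using eq x by simp
    \<comment> \<open>With a right child the word would have length at least 2.\<close>
    then have "fr' = []"
      using bp' x st(3) by (cases fr') (auto simp: insert_last_def split: if_splits)
    then show ?thesis using Nil bp bp' x by simp
  next
    case (Cons r rs)
    then have r: "fr = [r]" "1 \<le> i" "i \<le> weight r" "blue_packed r"
      using bp x by auto
    have "fr' \<noteq> []"
      using eq x r st(3) by (auto simp: insert_last_def split: if_splits)
    then obtain r' where r': "fr' = [r']" "1 \<le> i'" "i' \<le> weight r'" "blue_packed r'"
      using bp' x by auto
    have "tree_word r = tree_word r' \<and> i = i' \<and> \<alpha> = \<alpha>'"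
      by (rule insert_last_inj) (use eq x r r' st in auto)
    then show ?thesis using assms(1) r r' x by simp
  qed
qed

text \<open>The construction is undone layer by layer: \<open>pconc\<close> separates the root
  factor from the left forest, \<open>sconc\<close> separates the trees of that forest, and
  \<open>insert_last\<close> yields the label and the right child.\<close>

lemma tree_word_inj:
  "blue_packed t \<Longrightarrow> blue_packed t' \<Longrightarrow> tree_word t = tree_word t' \<Longrightarrow> t = t'"
proof (induction t arbitrary: t')
  case (Node x fl fr)
  obtain x' fl' fr' where t': "t' = Node x' fl' fr'" by (cases t') auto
  have bl: "\<forall>t\<in>set fl. blue_packed t" "\<forall>t\<in>set fl'. blue_packed t" "\<forall>t\<in>set fr. blue_packed t"
    using Node.prems(1,2) unfolding t' by (cases x; cases x'; simp)+
  have "root_word x (map tree_word fr) = root_word x' (map tree_word fr') \<and>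
      forest_word fl = forest_word fl'"
    by (rule pconc_tirr_unique)
       (use Node.prems t' bl tirr_root_word packed_forest_word tree_word_Node in metis)+
  moreover have "fl = fl'" if "forest_word fl = forest_word fl'"
    by (rule forest_word_inj) (use Node.IH(1) bl that in auto)
  moreover have "x = x' \<and> fr = fr'" if "root_word x (map tree_word fr) = root_word x' (map tree_word fr')"
    by (rule root_word_inj[OF _ Node.prems(1) Node.prems(2)[unfolded t']])
       (use Node.IH(2) bl that in auto)
  ultimately show ?case using t' by blast
qed

section \<open>Surjectivity of the word maps\<close>

lemma forest_word_surj:
  assumes "\<And>w'. irr w' \<Longrightarrow> length w' \<le> length w \<Longrightarrow> \<exists>t. blue_packed t \<and> tree_word t = w'"
    and "packed w"
  shows "\<exists>f. (\<forall>t\<in>set f. blue_packed t) \<and> forest_word f = w"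
  using assms
proof (induction "length w" arbitrary: w rule: less_induct)
  case less
  show ?case
  proof (cases "w = []")
    case True
    then show ?thesis by (intro exI[of _ "[]"]) simp
  next
    case False
    then obtain u v where uv: "irr u" "packed v" "w = sconc u v"
      using sconc_irr_exists less.prems by blast
    have "u \<noteq> []" using uv by (simp add: irr_def)
    then have "length v < length w" using uv(3) by simp
    then obtain f where "\<forall>t\<in>set f. blue_packed t" "forest_word f = v"
      using less.hyps[of v] less.prems(1) uv(2) by (meson le_trans less_or_eq_imp_le)
    moreover obtain t where "blue_packed t" "tree_word t = u"
      using less.prems(1)[of u] uv by auto
    ultimately show ?thesis
      using uv by (intro exI[of _ "t # f"]) simp
  qed
qed

text \<open>Strong induction on the length: the inserted word \<open>v\<close>, and the word
  \<open>x\<close> left after deleting the last letter of the totally irreducible factor, are both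
  shorter than \<open>w\<close>.\<close>

lemma tree_word_surj: "irr w \<Longrightarrow> \<exists>t. blue_packed t \<and> tree_word t = w"
proof (induction "length w" arbitrary: w rule: less_induct)
  case less
  obtain u v where uv: "tirr u" "packed v" "w = pconc u v"
    using pconc_tirr_exists less.prems by blast
  have une: "u \<noteq> []" using uv tirr_packed by blast
  then have "length v < length w" using uv(3) by simp
  then obtain fl where fl: "\<forall>t\<in>set fl. blue_packed t" "forest_word fl = v"
    using forest_word_surj[of v] less.hyps uv(2) by (meson le_less_trans)
  show ?case
  proof (cases "length u = 1")
    case True
    then obtain a where a: "u = [a]" by (auto simp: length_Suc_conv)
    have pu: "packed u" using uv tirr_packed by blast
    have "a \<in> set u" using a by simp
    moreover have "1 \<in> set u" using packed_mem[OF pu] wmax_pos[OF pu une] by blast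
    ultimately have "u = [1]" using a by simp
    then show ?thesis
      using fl uv by (intro exI[of _ "Node (1, Circ) fl []"]) (simp del: tree_word.simps add: tree_word_Node)
  next
    case False
    then have "2 \<le> length u" using une by (cases u) (auto simp: Suc_le_eq)
    then obtain x i \<alpha> where x: "irr x" "1 \<le> i" "i \<le> wmax x" "(i, \<alpha>) \<noteq> (1, Circ)"
      "u = insert_last x i \<alpha>"
      using tirr_insert_last_exists uv(1) by blast
    have "length x < length w" using x uv une by simp
    then obtain r where r: "blue_packed r" "tree_word r = x"
      using less.hyps x by blast
    \<comment> \<open>This makes the bound on the appended letter the one required of the root
      label.\<close>
    have "wmax x = weight r"
      using tree_word_stats[OF r(1)] r(2) by (simp add: word_of_tree_def)
    then have "blue_packed (Node (i, \<alpha>) fl [r])"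
      using fl x r by simp
    moreover have "tree_word (Node (i, \<alpha>) fl [r]) = w"
      using fl x r uv by (simp del: tree_word.simps add: tree_word_Node)
    ultimately show ?thesis by blast
  qed
qed

text \<open>The root factor is always totally irreducible; a nonempty left forest inserts a nonempty
  word before its last letter and so creates a \<open>pdecomp\<close>.\<close>

lemma tirr_tree_word_iff:
  assumes "blue_packed t"
  shows "tirr (tree_word t) \<longleftrightarrow> left_forest t = []"
proof -
  obtain x fl fr where t: "t = Node x fl fr" by (cases t) auto
  have fl: "\<forall>t\<in>set fl. blue_packed t"
    using assms unfolding t by (cases x) simp
  have R: "tirr (root_word x (map tree_word fr))"
    using tirr_root_word assms t by blast
  show ?thesis
  proof (cases "fl = []")
    case True
    then show ?thesis
      using R t tirr_packed(2)[OF R] tree_word_Node[of x fl fr] by simp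
  next
    case False
    then have "forest_word fl \<noteq> []"
      using forest_word_eq_Nil_iff fl by blast
    then have "pdecomp (tree_word t)"
      unfolding t tree_word_Node
      using pdecomp_pconc tirr_packed(2)[OF R] packed_forest_word[OF fl] by blast
    then show ?thesis
      using t False by (simp add: tirr_def)
  qed
qed

section \<open>Counting trees and forests by words\<close>

lemma card_blue_packed_trees: "card (blue_packed_trees n) = card {w \<in> PW n. irr w}"
proof (rule bij_betw_same_card)
  show "bij_betw tree_word (blue_packed_trees n) {w \<in> PW n. irr w}"
    unfolding bij_betw_def
  proof
    show "inj_on tree_word (blue_packed_trees n)"
      using tree_word_inj by (auto simp: blue_packed_trees_def inj_on_def)
    show "tree_word ` blue_packed_trees n = {w \<in> PW n. irr w}"
      using tree_word_stats tree_word_surj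
      by (fastforce simp: blue_packed_trees_def PW_def word_of_tree_def irr_def image_iff)
  qed
qed

lemma card_blue_packed_trees_left_Nil:
  "card {t \<in> blue_packed_trees n. left_forest t = []} = card {w \<in> PW n. tirr w}"
proof (rule bij_betw_same_card)
  show "bij_betw tree_word {t \<in> blue_packed_trees n. left_forest t = []} {w \<in> PW n. tirr w}"
    unfolding bij_betw_def
  proof
    show "inj_on tree_word {t \<in> blue_packed_trees n. left_forest t = []}"
      using tree_word_inj by (auto simp: blue_packed_trees_def inj_on_def)
    show "tree_word ` {t \<in> blue_packed_trees n. left_forest t = []} = {w \<in> PW n. tirr w}"
    proof
      show "tree_word ` {t \<in> blue_packed_trees n. left_forest t = []} \<subseteq> {w \<in> PW n. tirr w}"
        using tree_word_stats tirr_tree_word_iff tirr_packed(1)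
        by (auto simp: blue_packed_trees_def PW_def word_of_tree_def)
      show "{w \<in> PW n. tirr w} \<subseteq> tree_word ` {t \<in> blue_packed_trees n. left_forest t = []}"
      proof
        fix w assume w: "w \<in> {w \<in> PW n. tirr w}"
        then obtain t where t: "blue_packed t" "tree_word t = w"
          using tree_word_surj tirr_packed(3) by blast
        then have "t \<in> {t \<in> blue_packed_trees n. left_forest t = []}"
          using w tirr_tree_word_iff[of t] tree_word_stats[of t]
          by (simp add: blue_packed_trees_def PW_def word_of_tree_def)
        then show "w \<in> tree_word ` {t \<in> blue_packed_trees n. left_forest t = []}"
          using t by blast
      qed
    qed
  qed
qed

lemma card_blue_packed_forests: "card (blue_packed_forests n) = card (PW n)"
proof (rule bij_betw_same_card)
  show "bij_betw forest_word (blue_packed_forests n) (PW n)"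
    unfolding bij_betw_def
  proof
    show "inj_on forest_word (blue_packed_forests n)"
      using forest_word_inj tree_word_inj unfolding blue_packed_forests_def inj_on_def
      by (metis (mono_tags, lifting) mem_Collect_eq)
    show "forest_word ` blue_packed_forests n = PW n"
    proof
      show "forest_word ` blue_packed_forests n \<subseteq> PW n"
        using packed_forest_word length_forest_word by (auto simp: blue_packed_forests_def PW_def)
      show "PW n \<subseteq> forest_word ` blue_packed_forests n"
      proof
        fix w assume w: "w \<in> PW n"
        then obtain f where "\<forall>t\<in>set f. blue_packed t" "forest_word f = w"
          using forest_word_surj tree_word_surj PW_def by (metis (mono_tags, lifting) mem_Collect_eq)
        then show "w \<in> forest_word ` blue_packed_forests n"
          using w length_forest_word[of f] by (auto simp: blue_packed_forests_def PW_def)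
      qed
    qed
  qed
qed

section \<open>Triangular systems of linear equations\<close>

text \<open>Back substitution from the largest element down. Each step adds a new minimum
  \<open>b\<close>: its equation contains \<open>f b\<close> once and otherwise values already
  fixed, while the earlier equations do not involve \<open>b\<close>.\<close>

lemma triangular_solution_exists:
  fixes X :: "'a::linorder set" and g :: "'a \<Rightarrow> 'k::field"
  assumes "finite X" "\<And>w. w \<in> X - S \<Longrightarrow> w \<in> L w \<and> L w \<subseteq> {x \<in> X. w \<le> x}"
  shows "\<exists>f. (\<forall>x\<in>X \<inter> S. f x = g x) \<and> (\<forall>w\<in>X - S. (\<Sum>x\<in>L w. f x) = 0)"
  using assms
proof (induction X rule: finite_linorder_min_induct)
  case empty
  then show ?case by simp
next
  case (insert b X)
  have "w \<in> L w \<and> L w \<subseteq> {x \<in> X. w \<le> x}" if "w \<in> X - S" for w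
    using insert.prems[of w] insert.hyps(2) that by fastforce
  then obtain f where f: "\<forall>x\<in>X \<inter> S. f x = g x" "\<forall>w\<in>X - S. (\<Sum>x\<in>L w. f x) = 0"
    and L: "\<And>w. w \<in> X - S \<Longrightarrow> L w \<subseteq> X"
    using insert.IH by blast
  \<comment> \<open>On \<open>S\<close> the value is prescribed, outside \<open>S\<close> the
    equation led by \<open>b\<close> determines it.\<close>
  define c where "c = (if b \<in> S then g b else - (\<Sum>x\<in>L b - {b}. f x))"
  have b: "b \<notin> X" using insert.hyps by blast
  have "(f(b := c)) x = g x" if "x \<in> insert b X \<inter> S" for x
    using that f(1) b by (auto simp: c_def)
  moreover have "(\<Sum>x\<in>L w. (f(b := c)) x) = 0" if w: "w \<in> insert b X - S" for w
  proof (cases "w = b")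
    case True
    then have bL: "b \<in> L b" "L b \<subseteq> insert b X" "b \<notin> S"
      using insert.prems[of b] w by auto
    then have "finite (L b)"
      using insert.hyps(1) finite_subset by blast
    then have "(\<Sum>x\<in>L b. (f(b := c)) x) = c + (\<Sum>x\<in>L b - {b}. (f(b := c)) x)"
      using bL(1) by (simp add: sum.remove)
    also have "(\<Sum>x\<in>L b - {b}. (f(b := c)) x) = (\<Sum>x\<in>L b - {b}. f x)"
      by (rule sum.cong) auto
    finally show ?thesis
      using bL(3) True by (simp add: c_def)
  next
    case False
    then have "w \<in> X - S" using w by blast
    moreover have "(\<Sum>x\<in>L w. (f(b := c)) x) = (\<Sum>x\<in>L w. f x)"
      by (rule sum.cong) (use L[OF calculation] b in auto)
    ultimately show ?thesis using f(2) by simp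
  qed
  ultimately show ?case by blast
qed

text \<open>Restriction to the free coordinates \<open>S\<close> is an isomorphism from the solution
  space: injective by looking at the largest support element, surjective by back
  substitution.\<close>

lemma dim_triangular:
  fixes X :: "'a::linorder set"
  assumes X: "finite X" "S \<subseteq> X"
    and L: "\<And>w. w \<in> X - S \<Longrightarrow> w \<in> L w \<and> L w \<subseteq> {x \<in> X. w \<le> x}"
  shows "free_vs.dim {p :: 'a \<Rightarrow>\<^sub>0 'k::field. Poly_Mapping.keys p \<subseteq> X \<and>
           (\<forall>w\<in>X - S. (\<Sum>x\<in>L w. Poly_Mapping.lookup p x) = 0)} = card S"
proof -
  define V where "V = {p :: 'a \<Rightarrow>\<^sub>0 'k. Poly_Mapping.keys p \<subseteq> X \<and>
           (\<forall>w\<in>X - S. (\<Sum>x\<in>L w. Poly_Mapping.lookup p x) = 0)}"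
  have fS: "finite S" using X finite_subset by blast
  have V_add: "p + q \<in> V" if "p \<in> V" "q \<in> V" for p q
    using that Poly_Mapping.keys_add[of p q] unfolding V_def by (auto simp: lookup_add sum.distrib)
  have V_scale: "pm_scale c p \<in> V" if "p \<in> V" for c p
    using that unfolding V_def by (auto simp: in_keys_iff sum_distrib_left[symmetric])
  have "0 \<in> V"
    by (simp add: V_def)
  then have sub: "free_vs.subspace V"
    unfolding free_vs.subspace_def using V_add V_scale by blast
  have uniq: "p = 0" if p: "p \<in> V" and 0: "\<forall>s\<in>S. Poly_Mapping.lookup p s = 0" for p
  proof (rule ccontr)
    assume "p \<noteq> 0"
    \<comment> \<open>The equation led by the largest support element has no other term in the
      support, which forces its coefficient to vanish.\<close>
    define w where "w = Max (Poly_Mapping.keys p)"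
    have ne: "Poly_Mapping.keys p \<noteq> {}" using \<open>p \<noteq> 0\<close> by simp
    then have w: "w \<in> Poly_Mapping.keys p" unfolding w_def by (intro Max_in) auto
    then have wXS: "w \<in> X - S" using p 0 by (auto simp: V_def in_keys_iff)
    have fL: "finite (L w)" "w \<in> L w" using L[OF wXS] X(1) finite_subset by (auto intro: finite_subset)
    have "Poly_Mapping.lookup p x = 0" if "x \<in> L w - {w}" for x
    proof -
      have "w < x" using L[OF wXS] that by fastforce
      then have "x \<notin> Poly_Mapping.keys p"
        unfolding w_def using ne by (meson Max_ge finite_keys linorder_not_less)
      then show ?thesis by (simp add: in_keys_iff)
    qed
    then have "(\<Sum>x\<in>L w. Poly_Mapping.lookup p x) = Poly_Mapping.lookup p w"
      using fL by (simp add: sum.remove[of _ w])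
    then show False
      using p wXS w by (simp add: V_def in_keys_iff)
  qed
  \<comment> \<open>Prescribing indicator values on \<open>S\<close> gives the solutions dual to the
    coordinates in \<open>S\<close>; they will form the basis.\<close>
  have "\<exists>p\<in>V. \<forall>x\<in>S. Poly_Mapping.lookup p x = (if x = s then 1 else 0)" for s
  proof -
    obtain f :: "'a \<Rightarrow> 'k" where f: "\<forall>x\<in>X \<inter> S. f x = (if x = s then 1 else 0)"
      "\<forall>w\<in>X - S. (\<Sum>x\<in>L w. f x) = 0"
      using triangular_solution_exists[OF X(1) L, of S "\<lambda>x. if x = s then 1 else 0"] by blast
    define p where "p = Poly_Mapping.Abs_poly_mapping (\<lambda>x. if x \<in> X then f x else 0)"
    have "finite {x. (if x \<in> X then f x else 0) \<noteq> 0}"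
      by (rule finite_subset[OF _ X(1)]) auto
    then have lp: "Poly_Mapping.lookup p x = (if x \<in> X then f x else 0)" for x
      unfolding p_def by simp
    have "(\<Sum>x\<in>L w. Poly_Mapping.lookup p x) = 0" if "w \<in> X - S" for w
    proof -
      have "(\<Sum>x\<in>L w. Poly_Mapping.lookup p x) = (\<Sum>x\<in>L w. f x)"
        by (rule sum.cong) (use L[OF that] in \<open>auto simp: lp\<close>)
      then show ?thesis using f(2) that by simp
    qed
    moreover have "Poly_Mapping.keys p \<subseteq> X"
      by (auto simp: in_keys_iff lp split: if_splits)
    ultimately have "p \<in> V"
      by (simp add: V_def)
    moreover have "\<forall>x\<in>S. Poly_Mapping.lookup p x = (if x = s then 1 else 0)"
      using f(1) X(2) by (auto simp: lp)
    ultimately show ?thesis by blast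
  qed
  then obtain b where bV: "\<And>s. b s \<in> V"
    and b: "\<And>s x. x \<in> S \<Longrightarrow> Poly_Mapping.lookup (b s) x = (if x = s then 1 else 0)"
    by metis
  have inj: "inj_on b S"
    by (rule inj_onI) (metis b one_neq_zero)
  have comb: "Poly_Mapping.lookup (\<Sum>s\<in>S. pm_scale (c s) (b s)) x = c x" if "x \<in> S" for c x
  proof -
    have "Poly_Mapping.lookup (\<Sum>s\<in>S. pm_scale (c s) (b s)) x = (\<Sum>s\<in>S. if x = s then c s else 0)"
      unfolding lookup_sum by (rule sum.cong) (use b that in auto)
    then show ?thesis
      using fS that by simp
  qed
  show ?thesis
    unfolding V_def[symmetric]
  proof (rule free_vs.dim_unique)
    show "b ` S \<subseteq> V" using bV by blast
    show "card (b ` S) = card S" using inj by (rule card_image)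
    show "V \<subseteq> free_vs.span (b ` S)"
    proof
      fix p assume p: "p \<in> V"
      define q where "q = (\<Sum>s\<in>S. pm_scale (Poly_Mapping.lookup p s) (b s))"
      have "q \<in> V"
        unfolding q_def by (intro free_vs.subspace_sum[OF sub] free_vs.subspace_scale[OF sub] bV)
      then have "p - q \<in> V"
        using p free_vs.subspace_diff[OF sub] by blast
      moreover have "\<forall>s\<in>S. Poly_Mapping.lookup (p - q) s = 0"
        using comb by (simp add: lookup_minus q_def)
      ultimately have "p = q"
        using uniq by fastforce
      then show "p \<in> free_vs.span (b ` S)"
        unfolding q_def
        by (metis (no_types, lifting) free_vs.span_sum free_vs.span_scale free_vs.span_base imageI)
    qed
    show "free_vs.independent (b ` S)"
    proof (rule free_vs.independent_if_scalars_zero)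
      show "finite (b ` S)" using fS by simp
      fix c p
      assume 0: "(\<Sum>x\<in>b ` S. pm_scale (c x) x) = 0" and "p \<in> b ` S"
      then obtain s where s: "s \<in> S" "p = b s" by blast
      have "(\<Sum>t\<in>S. pm_scale (c (b t)) (b t)) = 0"
        using 0 sum.reindex[OF inj] by (metis (no_types, lifting) comp_def sum.cong)
      then show "c p = 0"
        using comb[OF s(1), of "\<lambda>t. c (b t)"] s by simp
    qed
  qed
qed

section \<open>Shifted shuffles\<close>

text \<open>The dual of the coproduct: \<open>shifted_shuffles UNIV u v\<close> are the words in the shifted shuffle of
  \<open>u\<close> and \<open>v\<close>, \<open>shifted_shuffles {True} u v\<close> those whose last letter comes from \<open>u\<close> (dual to
  \<open>\<Delta>\<^sub>\<prec>\<close>) and \<open>shifted_shuffles {False} u v\<close> those whose last letter comes from \<open>v\<close> (dual to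
  \<open>\<Delta>\<^sub>\<succ>\<close>).\<close>

definition shifted_shuffles :: "bool set \<Rightarrow> nat list \<Rightarrow> nat list \<Rightarrow> nat list set" where
  "shifted_shuffles S u v = {w. letters_le w (wmax u) = u \<and>
     letters_gt w (wmax u) = map ((+) (wmax u)) v \<and> (last w \<le> wmax u) \<in> S}"

lemma letters_split_set: "set w = set (letters_le w m) \<union> set (letters_gt w m)"
  by (auto simp: letters_le_def letters_gt_def)

lemma letters_split_length: "length w = length (letters_le w m) + length (letters_gt w m)"
  by (induction w) (auto simp: letters_le_def letters_gt_def)

lemma shifted_shuffles_props:
  assumes "packed u" "packed v" "w \<in> shifted_shuffles S u v"
  shows "packed w" "wmax w = wmax u + wmax v" "length w = length u + length v"
proof -
  have "set w = {1..wmax u + wmax v}"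
    using assms(3) letters_split_set[of w "wmax u"] packed_union_shift[OF assms(1,2)]
    unfolding shifted_shuffles_def by simp
  then show "packed w" "wmax w = wmax u + wmax v"
    using packedI wmax_eq by blast+
  show "length w = length u + length v"
    using assms(3) letters_split_length[of w "wmax u"] unfolding shifted_shuffles_def by simp
qed

lemma finite_shifted_shuffles:
  assumes "packed u" "packed v"
  shows "finite (shifted_shuffles S u v)"
proof (rule finite_subset)
  show "shifted_shuffles S u v \<subseteq> PW (length u + length v)"
    using shifted_shuffles_props[OF assms] by (auto simp: PW_def)
qed (rule finite_PW)

lemma letters_shift:
  assumes "packed v"
  shows "letters_le (map ((+) m) v) m = []" "letters_gt (map ((+) m) v) m = map ((+) m) v"
  using packed_ge_1[OF assms] by (force simp: letters_le_def letters_gt_def filter_empty_conv filter_id_conv)+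

lemma letters_self: "letters_le u (wmax u) = u" "letters_gt u (wmax u) = []"
  using le_wmax[of _ u]
  by (auto simp: letters_le_def letters_gt_def filter_empty_conv filter_id_conv linorder_not_less)

lemma letters_append [simp]:
  "letters_le (x @ y) m = letters_le x m @ letters_le y m"
  "letters_gt (x @ y) m = letters_gt x m @ letters_gt y m"
  by (simp_all add: letters_le_def letters_gt_def)

section \<open>Lexicographically smallest words of shifted shuffles\<close>

lemma sconc_in_shifted_shuffles:
  assumes "packed v" "v \<noteq> []"
  shows "sconc u v \<in> shifted_shuffles {False} u v" "sconc u v \<in> shifted_shuffles UNIV u v"
proof -
  have "1 \<le> last v" using assms packed_ge_1 by simp
  then have "\<not> last (sconc u v) \<le> wmax u"
    using assms(2) by (simp add: sconc_def last_map)
  then show "sconc u v \<in> shifted_shuffles {False} u v" "sconc u v \<in> shifted_shuffles UNIV u v"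
    unfolding shifted_shuffles_def sconc_def
    by (simp_all add: letters_shift[OF assms(1)] letters_self)
qed

lemma pconc_in_shifted_shuffles:
  assumes "packed v" "u \<noteq> []"
  shows "pconc u v \<in> shifted_shuffles {True} u v"
proof -
  have u: "letters_le (butlast u) (wmax u) @ letters_le [last u] (wmax u) = u"
    "letters_gt (butlast u) (wmax u) @ letters_gt [last u] (wmax u) = []"
    using letters_self[of u] letters_append[of "butlast u" "[last u]" "wmax u"] assms(2) by simp_all
  then show ?thesis
    unfolding shifted_shuffles_def pconc_def
    using assms(2) le_wmax[of "last u" u] by (simp add: letters_shift[OF assms(1)])
qed

text \<open>Moving the letters up to \<open>m\<close> to the front can only make a word
  lexicographically smaller. The untouched tail \<open>z\<close> is there for \<open>pconc\<close>,
  where the last letter stays in place.\<close>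

lemma letters_append_le: "letters_le w m @ letters_gt w m @ z \<le> w @ z"
proof (induction w)
  case (Cons a w)
  show ?case
  proof (cases "a \<le> m")
    case True
    then show ?thesis using Cons by (simp add: letters_le_def letters_gt_def)
  next
    case False
    show ?thesis
    proof (cases "letters_le w m")
      case Nil
      then have "letters_gt w m = w"
        by (simp add: letters_le_def letters_gt_def filter_empty_conv filter_id_conv not_le)
      then show ?thesis using Nil False by (simp add: letters_le_def letters_gt_def)
    next
      \<comment> \<open>The first small letter \<open>b\<close> moves in front of the larger letter
        \<open>a\<close>, so the first position already decides.\<close>
      case (Cons b bs)
      then have "b \<in> set (letters_le w m)" by simp
      then have "b < a" using False by (simp add: letters_le_def)
      then show ?thesis using Cons False by (simp add: letters_le_def)
    qed
  qed
qed (simp add: letters_le_def letters_gt_def)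

lemma sconc_le_shifted_shuffle: "w \<in> shifted_shuffles S u v \<Longrightarrow> sconc u v \<le> w"
  using letters_append_le[of w "wmax u" "[]"] unfolding shifted_shuffles_def sconc_def by simp

lemma pconc_le_shifted_shuffle:
  assumes "w \<in> shifted_shuffles {True} u v" "u \<noteq> []"
  shows "pconc u v \<le> w"
proof -
  have w: "letters_le w (wmax u) = u" "letters_gt w (wmax u) = map ((+) (wmax u)) v"
    "last w \<le> wmax u"
    using assms unfolding shifted_shuffles_def by auto
  have "w \<noteq> []" using w(1) assms(2) by (auto simp: letters_le_def)
  then obtain y l where y: "w = y @ [l]" by (metis rev_exhaust)
  have "l \<le> wmax u" using w(3) y by simp
  then have "letters_le y (wmax u) @ [l] = u" "letters_gt y (wmax u) = map ((+) (wmax u)) v"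
    using w(1,2) unfolding y by (simp_all add: letters_le_def letters_gt_def)
  then have "pconc u v = letters_le y (wmax u) @ letters_gt y (wmax u) @ [l]"
    unfolding pconc_def by (metis butlast_snoc last_snoc)
  then show ?thesis
    using letters_append_le[of y "wmax u" "[l]"] y by simp
qed

lemma last_letters:
  "w \<noteq> [] \<Longrightarrow> last w \<le> m \<Longrightarrow> last (letters_le w m) = last w"
  "w \<noteq> [] \<Longrightarrow> m < last w \<Longrightarrow> last (letters_gt w m) = last w \<and> letters_gt w m \<noteq> []"
  by (cases w rule: rev_cases; simp add: letters_le_def letters_gt_def)+

text \<open>Associativity of the shifted shuffle. Tracking the factor that provides the last letter turns
  it into the three dendriform identities: \<open>q\<close> and \<open>p\<close> say that the last letter of a word in the
  triple shuffle comes from the first two factors, resp. the first one.\<close>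

lemma sum_shifted_shuffles_assoc:
  fixes f :: "nat list \<Rightarrow> 'k::comm_monoid_add"
  assumes pk: "packed a" "packed b" "packed c" and ne: "a \<noteq> []"
    and S: "\<And>p q p' q'. (p \<Longrightarrow> q) \<Longrightarrow> (q \<Longrightarrow> p' = p) \<Longrightarrow> (\<not> p \<Longrightarrow> q' = q) \<Longrightarrow>
        (p' \<in> S1 \<and> q \<in> S2) = (q' \<in> S3 \<and> p \<in> S4)"
  shows "(\<Sum>x\<in>shifted_shuffles S1 a b. \<Sum>w\<in>shifted_shuffles S2 x c. f w) =
         (\<Sum>y\<in>shifted_shuffles S3 b c. \<Sum>w\<in>shifted_shuffles S4 a y. f w)"
proof -
  define m k where "m = wmax a" and "k = wmax b"
  \<comment> \<open>The triple shifted shuffle, without any condition on the last letter. Both sides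
    turn out to sum over the same part of it.\<close>
  define T where "T = {w. letters_le w m = a \<and> letters_gt (letters_le w (m + k)) m = map ((+) m) b \<and>
      letters_gt w (m + k) = map ((+) (m + k)) c}"
  have le_le: "letters_le (letters_le w (m + k)) m = letters_le w m" for w
    unfolding letters_le_def filter_filter by (rule filter_cong) auto
  have gt_gt: "letters_gt (letters_gt w m) (m + k) = letters_gt w (m + k)" for w
    unfolding letters_gt_def filter_filter by (rule filter_cong) auto
  have le_gt: "letters_le (letters_gt w m) (m + k) = letters_gt (letters_le w (m + k)) m" for w
    unfolding letters_gt_def letters_le_def filter_filter by (rule filter_cong) auto
  have shift_le: "letters_le (map ((+) m) y) (m + k) = map ((+) m) (letters_le y k)" for y
    unfolding letters_le_def filter_map by (simp add: comp_def)
  have shift_gt: "letters_gt (map ((+) m) y) (m + k) = map ((+) m) (letters_gt y k)" for y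
    unfolding letters_gt_def filter_map by (simp add: comp_def)
  have shift_shift: "map ((+) m) (map ((+) k) z) = map ((+) (m + k)) z" for z :: "nat list"
    by (simp add: add.assoc)
  have wx: "wmax x = m + k" if "x \<in> shifted_shuffles S1 a b" for x
    using shifted_shuffles_props(2)[OF pk(1,2) that] m_def k_def by simp
  \<comment> \<open>The intermediate word \<open>x\<close> is determined by \<open>w\<close>, so the
    inner sets of the left-hand side are disjoint. The same holds for \<open>y\<close> on the
    right-hand side, which is recovered from its shift.\<close>
  have L: "x \<in> shifted_shuffles S1 a b \<and> w \<in> shifted_shuffles S2 x c \<longleftrightarrow>
      x = letters_le w (m + k) \<and> w \<in> T \<and>
      (last (letters_le w (m + k)) \<le> m) \<in> S1 \<and> (last w \<le> m + k) \<in> S2" for x w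
  proof
    assume "x \<in> shifted_shuffles S1 a b \<and> w \<in> shifted_shuffles S2 x c"
    then have x: "x \<in> shifted_shuffles S1 a b" and w: "w \<in> shifted_shuffles S2 x c" by auto
    have "letters_le x m = a" "letters_gt x m = map ((+) m) b" "(last x \<le> m) \<in> S1"
      using x unfolding shifted_shuffles_def m_def by blast+
    moreover have "letters_le w (m + k) = x" "letters_gt w (m + k) = map ((+) (m + k)) c"
      "(last w \<le> m + k) \<in> S2"
      using w unfolding shifted_shuffles_def wx[OF x] by blast+
    ultimately show "x = letters_le w (m + k) \<and> w \<in> T \<and>
      (last (letters_le w (m + k)) \<le> m) \<in> S1 \<and> (last w \<le> m + k) \<in> S2"
      unfolding T_def using le_le[of w] by (metis (mono_tags, lifting) mem_Collect_eq)
  next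
    assume A: "x = letters_le w (m + k) \<and> w \<in> T \<and>
      (last (letters_le w (m + k)) \<le> m) \<in> S1 \<and> (last w \<le> m + k) \<in> S2"
    then have T: "letters_le x m = a" "letters_gt x m = map ((+) m) b"
      "letters_gt w (m + k) = map ((+) (m + k)) c"
      unfolding T_def using le_le[of w] by (metis (mono_tags, lifting) mem_Collect_eq)+
    have x: "x \<in> shifted_shuffles S1 a b"
      unfolding shifted_shuffles_def m_def[symmetric] using T A by blast
    moreover have "w \<in> shifted_shuffles S2 x c"
      unfolding shifted_shuffles_def wx[OF x] using T A by blast
    ultimately show "x \<in> shifted_shuffles S1 a b \<and> w \<in> shifted_shuffles S2 x c" by blast
  qed
  have R: "y \<in> shifted_shuffles S3 b c \<and> w \<in> shifted_shuffles S4 a y \<longleftrightarrow>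
      letters_gt w m = map ((+) m) y \<and> w \<in> T \<and> (last y \<le> k) \<in> S3 \<and> (last w \<le> m) \<in> S4" for y w
  proof (cases "letters_gt w m = map ((+) m) y")
    case True
    have "letters_gt (letters_le w (m + k)) m = map ((+) m) (letters_le y k)"
      using le_gt[of w] shift_le[of y] True by simp
    then have "letters_le y k = b \<longleftrightarrow> letters_gt (letters_le w (m + k)) m = map ((+) m) b"
      using map_add_inj by metis
    moreover have "letters_gt w (m + k) = map ((+) m) (letters_gt y k)"
      using gt_gt[of w] shift_gt[of y] True by simp
    then have "letters_gt y k = map ((+) k) c \<longleftrightarrow> letters_gt w (m + k) = map ((+) (m + k)) c"
      using map_add_inj shift_shift[of c] by metis
    ultimately show ?thesis
      using True unfolding shifted_shuffles_def T_def m_def[symmetric] k_def[symmetric] mem_Collect_eq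
      by blast
  next
    case False
    then show ?thesis
      unfolding shifted_shuffles_def m_def[symmetric] by auto
  qed
  \<comment> \<open>Here \<open>p\<close> and \<open>q\<close> are \<open>last w \<le> m\<close> and
    \<open>last w \<le> m + k\<close>, whereas \<open>p'\<close> and \<open>q'\<close> are the
    corresponding conditions on the intermediate words \<open>x\<close> and
    \<open>y\<close>.\<close>
  have eq: "((last (letters_le w (m + k)) \<le> m) \<in> S1 \<and> (last w \<le> m + k) \<in> S2) =
      ((last y \<le> k) \<in> S3 \<and> (last w \<le> m) \<in> S4)"
    if w: "w \<in> T" "letters_gt w m = map ((+) m) y" for w y
  proof (rule S)
    have wne: "w \<noteq> []" using w(1) ne by (auto simp: T_def letters_le_def)
    show "last w \<le> m \<Longrightarrow> last w \<le> m + k" by simp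
    show "last w \<le> m + k \<Longrightarrow> (last (letters_le w (m + k)) \<le> m) = (last w \<le> m)"
      using last_letters(1)[OF wne] by simp
    assume "\<not> last w \<le> m"
    then have "last (map ((+) m) y) = last w" "y \<noteq> []"
      using last_letters(2)[OF wne, of m] w(2) by auto
    then show "(last y \<le> k) = (last w \<le> m + k)"
      by (auto simp: last_map)
  qed
  have ex: "\<exists>y. letters_gt w m = map ((+) m) y" for w
    by (intro exI[of _ "map (\<lambda>a. a - m) (letters_gt w m)"])
       (auto simp: letters_gt_def comp_def intro!: map_idI[symmetric])
  have "(\<Sum>x\<in>shifted_shuffles S1 a b. \<Sum>w\<in>shifted_shuffles S2 x c. f w) =
      sum f (\<Union>x\<in>shifted_shuffles S1 a b. shifted_shuffles S2 x c)"
  proof (rule sum.UNION_disjoint[symmetric])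
    show "finite (shifted_shuffles S1 a b)"
      using finite_shifted_shuffles pk by blast
    show "\<forall>x\<in>shifted_shuffles S1 a b. finite (shifted_shuffles S2 x c)"
      using finite_shifted_shuffles shifted_shuffles_props(1) pk by blast
    show "\<forall>x\<in>shifted_shuffles S1 a b. \<forall>x'\<in>shifted_shuffles S1 a b. x \<noteq> x' \<longrightarrow>
        shifted_shuffles S2 x c \<inter> shifted_shuffles S2 x' c = {}"
    proof (intro ballI impI equals0I)
      fix x x' w
      assume "x \<in> shifted_shuffles S1 a b" "x' \<in> shifted_shuffles S1 a b" "x \<noteq> x'"
        "w \<in> shifted_shuffles S2 x c \<inter> shifted_shuffles S2 x' c"
      then have "x = letters_le w (m + k)" "x' = letters_le w (m + k)" "x \<noteq> x'"
        using L by (metis IntE)+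
      then show False by simp
    qed
  qed
  also have "(\<Union>x\<in>shifted_shuffles S1 a b. shifted_shuffles S2 x c) =
      (\<Union>y\<in>shifted_shuffles S3 b c. shifted_shuffles S4 a y)"
  proof (rule set_eqI)
    fix w
    have "w \<in> (\<Union>x\<in>shifted_shuffles S1 a b. shifted_shuffles S2 x c) \<longleftrightarrow>
        (\<exists>x. x \<in> shifted_shuffles S1 a b \<and> w \<in> shifted_shuffles S2 x c)"
      by blast
    also have "\<dots> \<longleftrightarrow>
        w \<in> T \<and> (last (letters_le w (m + k)) \<le> m) \<in> S1 \<and> (last w \<le> m + k) \<in> S2"
      unfolding L by simp
    also have "\<dots> \<longleftrightarrow> (\<exists>y. letters_gt w m = map ((+) m) y \<and> w \<in> T \<and> (last y \<le> k) \<in> S3 \<and>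
        (last w \<le> m) \<in> S4)"
      using eq[of w] ex[of w] by metis
    also have "\<dots> \<longleftrightarrow> (\<exists>y. y \<in> shifted_shuffles S3 b c \<and> w \<in> shifted_shuffles S4 a y)"
      unfolding R by simp
    also have "\<dots> \<longleftrightarrow> w \<in> (\<Union>y\<in>shifted_shuffles S3 b c. shifted_shuffles S4 a y)"
      by blast
    finally show "w \<in> (\<Union>x\<in>shifted_shuffles S1 a b. shifted_shuffles S2 x c) \<longleftrightarrow>
      w \<in> (\<Union>y\<in>shifted_shuffles S3 b c. shifted_shuffles S4 a y)" .
  qed
  also have "sum f (\<Union>y\<in>shifted_shuffles S3 b c. shifted_shuffles S4 a y) =
      (\<Sum>y\<in>shifted_shuffles S3 b c. \<Sum>w\<in>shifted_shuffles S4 a y. f w)"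
  proof (rule sum.UNION_disjoint)
    show "finite (shifted_shuffles S3 b c)"
      using finite_shifted_shuffles pk by blast
    show "\<forall>y\<in>shifted_shuffles S3 b c. finite (shifted_shuffles S4 a y)"
      using finite_shifted_shuffles shifted_shuffles_props(1) pk by blast
    show "\<forall>y\<in>shifted_shuffles S3 b c. \<forall>y'\<in>shifted_shuffles S3 b c. y \<noteq> y' \<longrightarrow>
        shifted_shuffles S4 a y \<inter> shifted_shuffles S4 a y' = {}"
    proof (intro ballI impI equals0I)
      fix y y' w
      assume "y \<in> shifted_shuffles S3 b c" "y' \<in> shifted_shuffles S3 b c" "y \<noteq> y'"
        "w \<in> shifted_shuffles S4 a y \<inter> shifted_shuffles S4 a y'"
      then have "map ((+) m) y = map ((+) m) y'" "y \<noteq> y'"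
        using R by (metis IntE)+
      then show False using map_add_inj by blast
    qed
  qed
  finally show ?thesis .
qed

section \<open>Reducing the primitivity equations to irreducible left factors\<close>

text \<open>Indexes the equations in degree \<open>n\<close>. Both factors are nonempty because the
  cuts in the coproducts run strictly between 0 and the maximum.\<close>

definition word_pair :: "nat \<Rightarrow> nat list \<Rightarrow> nat list \<Rightarrow> bool" where
  "word_pair n u v \<longleftrightarrow> packed u \<and> packed v \<and> u \<noteq> [] \<and> v \<noteq> [] \<and> length u + length v = n"

text \<open>Induction on the length and, within one length, downwards in lexicographic order. The
  latter is well-founded as there are finitely many packed words of each length.\<close>

lemma packed_induct [consumes 1, case_names packed]:
  assumes "packed u"
    and step: "\<And>u. packed u \<Longrightarrow>
      (\<And>x. packed x \<Longrightarrow> length x < length u \<Longrightarrow> P x) \<Longrightarrow>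
      (\<And>x. packed x \<Longrightarrow> length x = length u \<Longrightarrow> u < x \<Longrightarrow> P x) \<Longrightarrow> P u"
  shows "P u"
  using assms(1)
proof (induction "length u" arbitrary: u rule: less_induct)
  case less
  note outer = less
  show ?case
    using outer
  proof (induction "card {x \<in> PW (length u). u < x}" arbitrary: u rule: less_induct)
    case less
    show ?case
    proof (rule step)
      fix x assume x: "packed x" "length x = length u" "u < x"
      have "{z \<in> PW (length x). x < z} \<subset> {z \<in> PW (length u). u < z}"
        using x by (auto simp: PW_def)
      then have "card {z \<in> PW (length x). x < z} < card {z \<in> PW (length u). u < z}"
        using finite_PW by (intro psubset_card_mono) auto
      then show "P x"
        using less.hyps[of x] less.prems x by simp
    qed (use less.prems in auto)
  qed
qed

lemma sum_eq_0_leading: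
  fixes g :: "'a \<Rightarrow> 'k::comm_monoid_add"
  assumes "finite A" "u \<in> A" "(\<Sum>x\<in>A. g x) = 0" "\<And>x. x \<in> A \<Longrightarrow> x \<noteq> u \<Longrightarrow> g x = 0"
  shows "g u = 0"
proof -
  have "(\<Sum>x\<in>A. g x) = g u + (\<Sum>x\<in>A - {u}. g x)"
    using assms by (simp add: sum.remove)
  also have "(\<Sum>x\<in>A - {u}. g x) = 0"
    using assms(4) by (intro sum.neutral) auto
  finally show ?thesis using assms(3) by simp
qed

text \<open>With \<open>u = sconc a b\<close> and \<open>a\<close> irreducible, associativity, or
  \<open>(a * b) \<succ> v = a \<succ> (b \<succ> v)\<close>, expresses the sum of the equations for
  \<open>(x, v)\<close>, \<open>x\<close> in the shuffle of \<open>a\<close> and \<open>b\<close>,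
  through equations with left factor \<open>a\<close>. Every \<open>x \<noteq> u\<close> is larger
  than \<open>u\<close> and covered by induction, which isolates the equation for
  \<open>u\<close>.\<close>

lemma sum_shifted_shuffles_irr_reduction:
  fixes f :: "nat list \<Rightarrow> 'k::comm_monoid_add"
  assumes f: "\<And>u v. irr u \<Longrightarrow> word_pair n u v \<Longrightarrow> (\<Sum>w\<in>shifted_shuffles S u v. f w) = 0"
    and S: "S = UNIV \<or> S = {False}"
    and "word_pair n u v"
  shows "(\<Sum>w\<in>shifted_shuffles S u v. f w) = 0"
proof -
  have "packed u" using assms(3) by (simp add: word_pair_def)
  then show ?thesis
    using assms(3)
  proof (induction u rule: packed_induct)
    case (packed u)
    show ?case
    proof (cases "irr u")
      case True
      then show ?thesis using f packed.prems by blast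
    next
      case False
      have v: "packed v" "v \<noteq> []" "u \<noteq> []" "length u + length v = n"
        using packed.prems by (auto simp: word_pair_def)
      obtain a b where ab: "irr a" "packed b" "u = sconc a b"
        using sconc_irr_exists packed.hyps v(3) by blast
      have a: "packed a" "a \<noteq> []" using ab(1) by (auto simp: irr_def)
      have b: "b \<noteq> []" using False ab by auto
      show ?thesis
      proof (rule sum_eq_0_leading[where g = "\<lambda>x. \<Sum>w\<in>shifted_shuffles S x v. f w"])
        show "finite (shifted_shuffles UNIV a b)"
          using finite_shifted_shuffles a ab by blast
        show "u \<in> shifted_shuffles UNIV a b"
          using sconc_in_shifted_shuffles ab b by blast
        have "(\<Sum>x\<in>shifted_shuffles UNIV a b. \<Sum>w\<in>shifted_shuffles S x v. f w) =
            (\<Sum>y\<in>shifted_shuffles S b v. \<Sum>w\<in>shifted_shuffles S a y. f w)"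
          by (rule sum_shifted_shuffles_assoc) (use a ab v S in auto)
        also have "\<dots> = 0"
        proof (rule sum.neutral, rule ballI)
          fix y assume "y \<in> shifted_shuffles S b v"
          then have "packed y" "length y = length b + length v"
            using shifted_shuffles_props ab(2) v(1) by blast+
          then have "word_pair n a y"
            using a v b ab(3) by (auto simp: word_pair_def)
          then show "(\<Sum>w\<in>shifted_shuffles S a y. f w) = 0"
            using f ab(1) by blast
        qed
        finally show "(\<Sum>x\<in>shifted_shuffles UNIV a b. \<Sum>w\<in>shifted_shuffles S x v. f w) = 0" .
      next
        fix x assume x: "x \<in> shifted_shuffles UNIV a b" "x \<noteq> u"
        then have "packed x" "length x = length u"
          using shifted_shuffles_props[OF a(1) ab(2) x(1)] ab(3) by simp_all
        moreover have "u < x"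
          using sconc_le_shifted_shuffle x ab(3) by (metis order_le_imp_less_or_eq)
        moreover have "word_pair n x v"
          using calculation v by (auto simp: word_pair_def)
        ultimately show "(\<Sum>w\<in>shifted_shuffles S x v. f w) = 0"
          using packed.IH(2) by blast
      qed
    qed
  qed
qed

text \<open>Same elimination with two relations. If \<open>u\<close> decomposes,
  \<open>(a \<succ> b) \<prec> v = a \<succ> (b \<prec> v)\<close> leads to equations of the
  \<open>{False}\<close> family; if \<open>u = pconc a b\<close>, then
  \<open>(a \<prec> b) \<prec> v = a \<prec> (b * v)\<close> leads to \<open>{True}\<close>
  equations with the shorter left factor \<open>a\<close>.\<close>

lemma sum_shifted_shuffles_tirr_reduction:
  fixes f :: "nat list \<Rightarrow> 'k::comm_monoid_add"
  assumes suc: "\<And>u v. word_pair n u v \<Longrightarrow> (\<Sum>w\<in>shifted_shuffles {False} u v. f w) = 0"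
    and pre: "\<And>u v. tirr u \<Longrightarrow> word_pair n u v \<Longrightarrow> (\<Sum>w\<in>shifted_shuffles {True} u v. f w) = 0"
    and "word_pair n u v"
  shows "(\<Sum>w\<in>shifted_shuffles {True} u v. f w) = 0"
proof -
  have "packed u" using assms(3) by (simp add: word_pair_def)
  then show ?thesis
    using assms(3)
  proof (induction u arbitrary: v rule: packed_induct)
    case (packed u)
    have v: "packed v" "v \<noteq> []" "u \<noteq> []" "length u + length v = n"
      using packed.prems by (auto simp: word_pair_def)
    have IH: "(\<Sum>w\<in>shifted_shuffles {True} x v. f w) = 0"
      if "packed x" "length x = length u" "u \<le> x" "x \<noteq> u" for x
    proof -
      have "word_pair n x v"
        using that v by (auto simp: word_pair_def)
      then show ?thesis
        using packed.IH(2) that by (metis order_le_imp_less_or_eq)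
    qed
    consider "tirr u" | "decomp u" | "pdecomp u"
      using packed.hyps v(3) by (auto simp: tirr_def irr_def)
    then show ?case
    proof cases
      case 1
      then show ?thesis using pre packed.prems by blast
    next
      case 2
      then obtain a b where ab: "packed a" "packed b" "a \<noteq> []" "b \<noteq> []" "u = sconc a b"
        using decompE packed.hyps by metis
      show ?thesis
      proof (rule sum_eq_0_leading[where g = "\<lambda>x. \<Sum>w\<in>shifted_shuffles {True} x v. f w"])
        show "finite (shifted_shuffles {False} a b)"
          using finite_shifted_shuffles ab by blast
        show "u \<in> shifted_shuffles {False} a b"
          using sconc_in_shifted_shuffles ab by blast
        have "(\<Sum>x\<in>shifted_shuffles {False} a b. \<Sum>w\<in>shifted_shuffles {True} x v. f w) =
            (\<Sum>y\<in>shifted_shuffles {True} b v. \<Sum>w\<in>shifted_shuffles {False} a y. f w)"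
          by (rule sum_shifted_shuffles_assoc) (use ab v in auto)
        also have "\<dots> = 0"
        proof (rule sum.neutral, rule ballI)
          fix y assume "y \<in> shifted_shuffles {True} b v"
          then have "packed y" "length y = length b + length v"
            using shifted_shuffles_props ab(2) v(1) by blast+
          then have "word_pair n a y"
            using v ab by (auto simp: word_pair_def)
          then show "(\<Sum>w\<in>shifted_shuffles {False} a y. f w) = 0"
            using suc by blast
        qed
        finally show "(\<Sum>x\<in>shifted_shuffles {False} a b.
            \<Sum>w\<in>shifted_shuffles {True} x v. f w) = 0" .
      next
        fix x assume x: "x \<in> shifted_shuffles {False} a b" "x \<noteq> u"
        then show "(\<Sum>w\<in>shifted_shuffles {True} x v. f w) = 0"
          using IH[of x] shifted_shuffles_props[OF ab(1,2) x(1)] ab(5)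
            sconc_le_shifted_shuffle[OF x(1)] by simp
      qed
    next
      case 3
      then obtain a b where ab: "packed a" "packed b" "a \<noteq> []" "b \<noteq> []" "u = pconc a b"
        using pdecompE packed.hyps by metis
      show ?thesis
      proof (rule sum_eq_0_leading[where g = "\<lambda>x. \<Sum>w\<in>shifted_shuffles {True} x v. f w"])
        show "finite (shifted_shuffles {True} a b)"
          using finite_shifted_shuffles ab by blast
        show "u \<in> shifted_shuffles {True} a b"
          using pconc_in_shifted_shuffles ab by blast
        have "(\<Sum>x\<in>shifted_shuffles {True} a b. \<Sum>w\<in>shifted_shuffles {True} x v. f w) =
            (\<Sum>y\<in>shifted_shuffles UNIV b v. \<Sum>w\<in>shifted_shuffles {True} a y. f w)"
          by (rule sum_shifted_shuffles_assoc) (use ab v in auto)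
        also have "\<dots> = 0"
        proof (rule sum.neutral, rule ballI)
          fix y assume "y \<in> shifted_shuffles UNIV b v"
          then have "packed y" "length y = length b + length v"
            using shifted_shuffles_props ab(2) v(1) by blast+
          then have "word_pair n a y" "length a < length u"
            using v ab by (auto simp: word_pair_def)
          then show "(\<Sum>w\<in>shifted_shuffles {True} a y. f w) = 0"
            using packed.IH(1) ab(1) by blast
        qed
        finally show "(\<Sum>x\<in>shifted_shuffles {True} a b.
            \<Sum>w\<in>shifted_shuffles {True} x v. f w) = 0" .
      next
        fix x assume x: "x \<in> shifted_shuffles {True} a b" "x \<noteq> u"
        then show "(\<Sum>w\<in>shifted_shuffles {True} x v. f w) = 0"
          using IH[of x] shifted_shuffles_props[OF ab(1,2) x(1)] ab(3,5)
            pconc_le_shifted_shuffle[OF x(1)] by simp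
      qed
    qed
  qed
qed

section \<open>The kernels of the coproducts\<close>

text \<open>The letters of a packed word above \<open>i\<close> fill an interval starting at
  \<open>i + 1\<close>, so packing them amounts to subtracting \<open>i\<close>.\<close>

lemma packed_cut:
  assumes w: "packed w" and i: "1 \<le> i" "i < wmax w"
  shows "packed (letters_le w i)" "wmax (letters_le w i) = i" "letters_le w i \<noteq> []"
    "packed (pack (letters_gt w i))" "pack (letters_gt w i) \<noteq> []"
    "letters_gt w i = map ((+) i) (pack (letters_gt w i))"
proof -
  have mem: "a \<in> set w \<longleftrightarrow> 1 \<le> a \<and> a \<le> wmax w" for a
    using w packed_iff[of w] by (metis atLeastAtMost_iff)
  have "a \<in> set (letters_le w i) \<longleftrightarrow> 1 \<le> a \<and> a \<le> i" for a
    using mem[of a] i by (auto simp: letters_le_def)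
  then have le: "set (letters_le w i) = {1..i}"
    by (simp add: set_eq_iff)
  then show "packed (letters_le w i)" "wmax (letters_le w i) = i"
    using packedI wmax_eq by blast+
  show "letters_le w i \<noteq> []"
    using le i by (metis atLeastAtMost_iff empty_iff order_refl set_empty)
  have gt: "a \<in> set (letters_gt w i) \<longleftrightarrow> i < a \<and> a \<le> wmax w" for a
    using mem[of a] i by (auto simp: letters_gt_def)
  have "card {b \<in> set (letters_gt w i). b \<le> a} = a - i" if "a \<in> set (letters_gt w i)" for a
  proof -
    have "{b \<in> set (letters_gt w i). b \<le> a} = {i<..a}"
      using that unfolding gt by auto
    then show ?thesis by simp
  qed
  then have pk: "pack (letters_gt w i) = map (\<lambda>a. a - i) (letters_gt w i)"
    unfolding pack_def by (rule map_cong[OF refl])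
  show eq: "letters_gt w i = map ((+) i) (pack (letters_gt w i))"
    unfolding pk map_map comp_def by (intro map_idI[symmetric]) (simp add: gt)
  have ne: "wmax w \<in> set (letters_gt w i)"
    using gt i by blast
  show "pack (letters_gt w i) \<noteq> []"
    using ne pk by auto
  have "set (letters_le w i) \<union> set (letters_gt w i) = {1..wmax w}"
    using letters_split_set[of w i] w packed_iff by metis
  moreover have "set (letters_le w i) \<noteq> {}" using \<open>letters_le w i \<noteq> []\<close> by simp
  moreover have "\<forall>a\<in>set (letters_le w i). \<forall>b\<in>set (letters_gt w i). a < b"
    by (auto simp: letters_le_def letters_gt_def)
  ultimately obtain v where "packed v" "letters_gt w i = map ((+) (wmax (letters_le w i))) v"
    using separated_packed by metis
  then show "packed (pack (letters_gt w i))"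
    using eq \<open>wmax (letters_le w i) = i\<close> map_add_inj by metis
qed

text \<open>The sets \<open>{True}\<close>, \<open>{False}\<close> and \<open>UNIV\<close> give
  \<open>\<Delta>\<^sub>\<prec>\<close>, \<open>\<Delta>\<^sub>\<succ>\<close> and their sum on
  nonempty packed words, so that one computation serves all three.\<close>

definition cut_coproduct :: "bool set \<Rightarrow> nat list \<Rightarrow> (nat list \<times> nat list \<Rightarrow>\<^sub>0 'k::field)" where
  "cut_coproduct S w = (\<Sum>i\<in>{i \<in> {1..<wmax w}. (last w \<le> i) \<in> S}.
     Q_tensor (letters_le w i) (pack (letters_gt w i)))"

text \<open>Duality between cutting and shuffling: only the cut at \<open>wmax u\<close> can produce
  the left factor \<open>u\<close>, and it produces \<open>(u, v)\<close> exactly when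
  \<open>w\<close> lies in the shifted shuffle.\<close>

lemma lookup_cut_coproduct:
  assumes w: "packed w"
  shows "Poly_Mapping.lookup (cut_coproduct S w :: _ \<Rightarrow>\<^sub>0 'k::field) (u, v) =
    (if packed u \<and> packed v \<and> u \<noteq> [] \<and> v \<noteq> [] \<and> w \<in> shifted_shuffles S u v then 1 else 0)"
proof -
  let ?I = "{i \<in> {1..<wmax w}. (last w \<le> i) \<in> S}"
  let ?good = "packed u \<and> packed v \<and> u \<noteq> [] \<and> v \<noteq> [] \<and> w \<in> shifted_shuffles S u v"
  have iff: "letters_le w i = u \<and> pack (letters_gt w i) = v \<longleftrightarrow> i = wmax u \<and> ?good"
    if i: "i \<in> ?I" for i
  proof -
    have i': "1 \<le> i" "i < wmax w" "(last w \<le> i) \<in> S" using i by auto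
    note cut = packed_cut[OF w i'(1,2)]
    show ?thesis
    proof
      assume "letters_le w i = u \<and> pack (letters_gt w i) = v"
      then have u: "letters_le w i = u" and v: "pack (letters_gt w i) = v" by auto
      have "wmax u = i" using cut(2) u by simp
      then have "w \<in> shifted_shuffles S u v"
        unfolding shifted_shuffles_def using u v cut(6) i'(3) by simp
      then show "i = wmax u \<and> ?good"
        using \<open>wmax u = i\<close> cut(1,3,4,5) unfolding u v by blast
    next
      assume A: "i = wmax u \<and> ?good"
      then have "letters_le w i = u" "letters_gt w i = map ((+) i) v"
        unfolding shifted_shuffles_def by blast+
      then show "letters_le w i = u \<and> pack (letters_gt w i) = v"
        using cut(6) map_add_inj by metis
    qed
  qed
  have wI: "wmax u \<in> ?I" if g: ?good
  proof -
    have "wmax w = wmax u + wmax v" using g shifted_shuffles_props(2) by blast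
    then show ?thesis
      using g wmax_pos[of u] wmax_pos[of v] unfolding shifted_shuffles_def by simp
  qed
  have "Poly_Mapping.lookup (cut_coproduct S w :: _ \<Rightarrow>\<^sub>0 'k) (u, v) =
      (\<Sum>i\<in>?I. if letters_le w i = u \<and> pack (letters_gt w i) = v then 1 else 0)"
    unfolding cut_coproduct_def lookup_sum Q_tensor_def lookup_single
    by (rule sum.cong) (auto simp: when_def)
  also have "\<dots> = (\<Sum>i\<in>?I. if i = wmax u then (if ?good then 1 else 0) else 0)"
    by (rule sum.cong[OF refl]) (simp only: iff, simp)
  also have "\<dots> = (if ?good then 1 else 0)"
    using wI by (subst sum.delta) auto
  finally show ?thesis .
qed

definition cut_map :: "bool set \<Rightarrow> nat \<Rightarrow> (nat list \<Rightarrow>\<^sub>0 'k::field) \<Rightarrow> (nat list \<times> nat list \<Rightarrow>\<^sub>0 'k)" where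
  "cut_map S n p = (\<Sum>w\<in>PW n. pm_scale (Poly_Mapping.lookup p w) (cut_coproduct S w))"

lemma cut_map_eq_0_iff:
  "cut_map S n p = 0 \<longleftrightarrow>
    (\<forall>u v. word_pair n u v \<longrightarrow> (\<Sum>w\<in>shifted_shuffles S u v. Poly_Mapping.lookup p w) = 0)"
proof -
  have lk: "Poly_Mapping.lookup (cut_map S n p) (u, v) =
      (if word_pair n u v then \<Sum>w\<in>shifted_shuffles S u v. Poly_Mapping.lookup p w else 0)" for u v
  proof -
    have "Poly_Mapping.lookup (cut_map S n p) (u, v) = (\<Sum>w\<in>PW n. Poly_Mapping.lookup p w *
        (if packed u \<and> packed v \<and> u \<noteq> [] \<and> v \<noteq> [] \<and> w \<in> shifted_shuffles S u v then 1 else 0))"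
      unfolding cut_map_def lookup_sum lookup_pm_scale
      by (rule sum.cong[OF refl]) (subst lookup_cut_coproduct, simp_all add: PW_def)
    also have "\<dots> = (\<Sum>w\<in>PW n. if word_pair n u v \<and> w \<in> shifted_shuffles S u v
        then Poly_Mapping.lookup p w else 0)"
    proof (rule sum.cong[OF refl])
      fix w assume "w \<in> PW n"
      then have "packed u \<and> packed v \<and> u \<noteq> [] \<and> v \<noteq> [] \<and> w \<in> shifted_shuffles S u v \<longleftrightarrow>
          word_pair n u v \<and> w \<in> shifted_shuffles S u v"
        using shifted_shuffles_props(3)[of u v w S] unfolding word_pair_def PW_def by auto
      then show "Poly_Mapping.lookup p w *
        (if packed u \<and> packed v \<and> u \<noteq> [] \<and> v \<noteq> [] \<and> w \<in> shifted_shuffles S u v then 1 else 0) =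
        (if word_pair n u v \<and> w \<in> shifted_shuffles S u v then Poly_Mapping.lookup p w else 0)"
        by simp
    qed
    also have "\<dots> = (if word_pair n u v then \<Sum>w\<in>shifted_shuffles S u v. Poly_Mapping.lookup p w else 0)"
    proof (cases "word_pair n u v")
      case True
      then have "shifted_shuffles S u v \<subseteq> PW n"
        using shifted_shuffles_props unfolding word_pair_def PW_def by blast
      then show ?thesis
        using True finite_PW[of n] by (simp add: sum.inter_restrict[symmetric] Int_absorb1)
    qed simp
    finally show ?thesis .
  qed
  show ?thesis
  proof
    assume "cut_map S n p = 0"
    then show "\<forall>u v. word_pair n u v \<longrightarrow> (\<Sum>w\<in>shifted_shuffles S u v. Poly_Mapping.lookup p w) = 0"
      using lk by (metis lookup_zero)
  next
    assume "\<forall>u v. word_pair n u v \<longrightarrow> (\<Sum>w\<in>shifted_shuffles S u v. Poly_Mapping.lookup p w) = 0"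
    then show "cut_map S n p = 0"
      by (intro poly_mapping_eqI) (auto simp: lk)
  qed
qed

text \<open>A nonempty packed word has \<open>1 \<le> last w \<le> wmax w\<close>, so the two
  summation ranges divide \<open>{1..<wmax w}\<close> according to the side on which the last letter
  falls.\<close>

lemma Delta_eq_cut_map:
  assumes p: "p \<in> WQSym n" and n: "0 < n"
  shows "Delta_prec p = cut_map {True} n p" "Delta_succ p = cut_map {False} n p"
    "Delta_prec p + Delta_succ p = cut_map UNIV n p"
proof -
  have K: "Poly_Mapping.keys p \<subseteq> PW n" using p by (simp add: WQSym_def)
  have w: "1 \<le> last w" "last w \<le> wmax w" if "w \<in> PW n" for w
  proof -
    have "packed w" "w \<noteq> []" using that n by (auto simp: PW_def)
    then show "1 \<le> last w" "last w \<le> wmax w" using packed_ge_1 le_wmax by simp_all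
  qed
  show P: "Delta_prec p = cut_map {True} n p"
    unfolding Delta_prec_def cut_map_def cut_coproduct_def lin_extend_superset[OF finite_PW K]
  proof (rule sum.cong[OF refl])
    fix w assume "w \<in> PW n"
    then have "{last w..<wmax w} = {i \<in> {1..<wmax w}. (last w \<le> i) \<in> {True}}"
      using w[of w] by (auto simp: set_eq_iff)
    then show "pm_scale (Poly_Mapping.lookup p w) (\<Sum>i\<in>{last w..<wmax w}.
        Q_tensor (letters_le w i) (pack (letters_gt w i))) =
      pm_scale (Poly_Mapping.lookup p w) (\<Sum>i\<in>{i \<in> {1..<wmax w}. (last w \<le> i) \<in> {True}}.
        Q_tensor (letters_le w i) (pack (letters_gt w i)))"
      by simp
  qed
  show S: "Delta_succ p = cut_map {False} n p"
    unfolding Delta_succ_def cut_map_def cut_coproduct_def lin_extend_superset[OF finite_PW K]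
  proof (rule sum.cong[OF refl])
    fix w assume "w \<in> PW n"
    then have "{1..<last w} = {i \<in> {1..<wmax w}. (last w \<le> i) \<in> {False}}"
      using w[of w] by (auto simp: set_eq_iff)
    then show "pm_scale (Poly_Mapping.lookup p w) (\<Sum>i\<in>{1..<last w}.
        Q_tensor (letters_le w i) (pack (letters_gt w i))) =
      pm_scale (Poly_Mapping.lookup p w) (\<Sum>i\<in>{i \<in> {1..<wmax w}. (last w \<le> i) \<in> {False}}.
        Q_tensor (letters_le w i) (pack (letters_gt w i)))"
      by simp
  qed
  have U: "(cut_coproduct UNIV x :: _ \<Rightarrow>\<^sub>0 'a) = cut_coproduct {True} x + cut_coproduct {False} x" for x
  proof -
    have "{i \<in> {1..<wmax x}. (last x \<le> i) \<in> UNIV} =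
      {i \<in> {1..<wmax x}. (last x \<le> i) \<in> {True}} \<union> {i \<in> {1..<wmax x}. (last x \<le> i) \<in> {False}}"
      by auto
    then show ?thesis
      unfolding cut_coproduct_def by (simp only:) (rule sum.union_disjoint, auto)
  qed
  show "Delta_prec p + Delta_succ p = cut_map UNIV n p"
    unfolding P S cut_map_def U by (simp add: free_vs.scale_right_distrib sum.distrib)
qed

section \<open>Dimensions\<close>

lemma not_irr_sconc:
  assumes "packed w" "w \<noteq> []" "\<not> irr w"
  obtains u v where "irr u" "packed v" "v \<noteq> []" "w = sconc u v"
proof -
  obtain u v where uv: "irr u" "packed v" "w = sconc u v"
    using sconc_irr_exists assms by blast
  then have "v \<noteq> []" using assms(3) by auto
  then show ?thesis using that uv by blast
qed

lemma irr_not_tirr_pconc: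
  assumes "irr w" "\<not> tirr w"
  obtains u v where "tirr u" "packed v" "v \<noteq> []" "w = pconc u v"
proof -
  obtain u v where uv: "tirr u" "packed v" "w = pconc u v"
    using pconc_tirr_exists assms by blast
  then have "v \<noteq> []" using assms(2) tirr_packed(2) by auto
  then show ?thesis using that uv by blast
qed

text \<open>\<open>C w A\<close> says that \<open>A\<close> is the support of the equation led by
  \<open>w\<close>. The relational form allows \<open>C\<close> to speak of the factors of
  \<open>w\<close> existentially; unique factorization supplies \<open>det\<close>.\<close>

lemma dim_leading_constraints:
  fixes X :: "'a::linorder set"
  assumes X: "finite X" "S \<subseteq> X"
    and ex: "\<And>w. w \<in> X - S \<Longrightarrow> \<exists>A. C w A"
    and det: "\<And>w A B. C w A \<Longrightarrow> C w B \<Longrightarrow> A = B"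
    and lead: "\<And>w A. w \<in> X - S \<Longrightarrow> C w A \<Longrightarrow> w \<in> A \<and> A \<subseteq> {x \<in> X. w \<le> x}"
  shows "free_vs.dim {p :: 'a \<Rightarrow>\<^sub>0 'k::field. Poly_Mapping.keys p \<subseteq> X \<and>
           (\<forall>w\<in>X - S. \<forall>A. C w A \<longrightarrow> (\<Sum>x\<in>A. Poly_Mapping.lookup p x) = 0)} = card S"
proof -
  obtain L where L: "\<And>w. w \<in> X - S \<Longrightarrow> C w (L w)"
    using ex by metis
  have eq: "(\<forall>w\<in>X - S. \<forall>A. C w A \<longrightarrow> (\<Sum>x\<in>A. Poly_Mapping.lookup p x) = 0) \<longleftrightarrow>
      (\<forall>w\<in>X - S. (\<Sum>x\<in>L w. Poly_Mapping.lookup p x) = 0)" for p :: "'a \<Rightarrow>\<^sub>0 'k"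
    using L det by metis
  show ?thesis
    unfolding eq by (rule dim_triangular[OF X]) (rule lead[OF _ L])
qed

lemma shifted_shuffles_above:
  assumes "word_pair n u v" "\<And>x. x \<in> shifted_shuffles S u v \<Longrightarrow> w \<le> x"
  shows "shifted_shuffles S u v \<subseteq> {x \<in> PW n. w \<le> x}"
  using assms shifted_shuffles_props unfolding word_pair_def PW_def by blast

lemma dim_WQSym: "free_vs.dim (WQSym n :: (nat list \<Rightarrow>\<^sub>0 'k::field) set) = card (PW n)"
  \<comment> \<open>With \<open>S = X\<close> there are no equations.\<close>
  using dim_triangular[OF finite_PW order_refl, of n "\<lambda>_. {}", where ?'k = 'k]
  by (simp add: WQSym_def)

lemma dim_Prim:
  assumes n: "0 < n"
  shows "free_vs.dim (Prim n :: (nat list \<Rightarrow>\<^sub>0 'k::field) set) = card {w \<in> PW n. irr w}"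
proof -
  \<comment> \<open>The equation for \<open>(u, v)\<close> with \<open>u\<close> irreducible is led
    by \<open>sconc u v\<close>. Hence each reducible word leads exactly one equation and the
    irreducible words remain free.\<close>
  define C where "C w A \<longleftrightarrow> (\<exists>u v. irr u \<and> packed v \<and> v \<noteq> [] \<and> w = sconc u v \<and>
      A = shifted_shuffles UNIV u v)" for w A
  let ?S = "{w \<in> PW n. irr w}"
  have pair: "word_pair n u v" if "irr u" "packed v" "v \<noteq> []" "sconc u v \<in> PW n" for u v
    using that by (auto simp: word_pair_def PW_def irr_def)
  have eq: "(\<forall>u v. word_pair n u v \<longrightarrow> (\<Sum>x\<in>shifted_shuffles UNIV u v. Poly_Mapping.lookup p x) = 0)
      \<longleftrightarrow> (\<forall>w\<in>PW n - ?S. \<forall>A. C w A \<longrightarrow> (\<Sum>x\<in>A. Poly_Mapping.lookup p x) = 0)"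
    for p :: "nat list \<Rightarrow>\<^sub>0 'k"
  proof (intro iffI ballI allI impI)
    fix w A
    assume "\<forall>u v. word_pair n u v \<longrightarrow> (\<Sum>x\<in>shifted_shuffles UNIV u v. Poly_Mapping.lookup p x) = 0"
      "w \<in> PW n - ?S" "C w A"
    then show "(\<Sum>x\<in>A. Poly_Mapping.lookup p x) = 0"
      using pair unfolding C_def by blast
  next
    fix u v
    assume A: "\<forall>w\<in>PW n - ?S. \<forall>A. C w A \<longrightarrow> (\<Sum>x\<in>A. Poly_Mapping.lookup p x) = 0"
      and uv: "word_pair n u v"
    have "(\<Sum>x\<in>shifted_shuffles UNIV u v. Poly_Mapping.lookup p x) = 0"
      if "irr u" "word_pair n u v" for u v
    proof -
      have v: "packed u" "packed v" "u \<noteq> []" "v \<noteq> []" "length u + length v = n"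
        using that(2) by (auto simp: word_pair_def)
      have "sconc u v \<in> PW n" "\<not> irr (sconc u v)"
        using v packed_sconc decomp_sconc by (auto simp: PW_def irr_def)
      moreover have "C (sconc u v) (shifted_shuffles UNIV u v)"
        unfolding C_def using that(1) v by blast
      ultimately show ?thesis
        using A by blast
    qed
    then show "(\<Sum>x\<in>shifted_shuffles UNIV u v. Poly_Mapping.lookup p x) = 0"
      using sum_shifted_shuffles_irr_reduction[where n = n and S = UNIV] uv by blast
  qed
  have "Prim n = {p :: nat list \<Rightarrow>\<^sub>0 'k. Poly_Mapping.keys p \<subseteq> PW n \<and>
      (\<forall>w\<in>PW n - ?S. \<forall>A. C w A \<longrightarrow> (\<Sum>x\<in>A. Poly_Mapping.lookup p x) = 0)}"
  proof (rule set_eqI)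
    fix p :: "nat list \<Rightarrow>\<^sub>0 'k"
    show "p \<in> Prim n \<longleftrightarrow> p \<in> {p. Poly_Mapping.keys p \<subseteq> PW n \<and>
      (\<forall>w\<in>PW n - ?S. \<forall>A. C w A \<longrightarrow> (\<Sum>x\<in>A. Poly_Mapping.lookup p x) = 0)}"
      unfolding mem_Collect_eq eq[of p, symmetric] cut_map_eq_0_iff[symmetric]
      using n Delta_eq_cut_map(3)[of p n] by (auto simp: Prim_def WQSym_def)
  qed
  also have "free_vs.dim \<dots> = card ?S"
  proof (rule dim_leading_constraints[OF finite_PW])
    show "\<exists>A. C w A" if "w \<in> PW n - ?S" for w
      using that n not_irr_sconc[of w] unfolding C_def PW_def by (metis (mono_tags, lifting)
          DiffD1 DiffD2 length_greater_0_conv mem_Collect_eq)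
    show "A = B" if "C w A" "C w B" for w A B
      using that sconc_irr_unique unfolding C_def by metis
    show "w \<in> A \<and> A \<subseteq> {x \<in> PW n. w \<le> x}" if "w \<in> PW n - ?S" "C w A" for w A
    proof -
      obtain u v where uv: "irr u" "packed v" "v \<noteq> []" "w = sconc u v" "A = shifted_shuffles UNIV u v"
        using \<open>C w A\<close> C_def by blast
      then show ?thesis
        using pair[of u v] shifted_shuffles_above[of n u v UNIV w] sconc_le_shifted_shuffle
          sconc_in_shifted_shuffles(2)[of v u] that(1) by blast
    qed
  qed auto
  finally show ?thesis .
qed

lemma dim_TPrim:
  assumes n: "0 < n"
  shows "free_vs.dim (TPrim n :: (nat list \<Rightarrow>\<^sub>0 'k::field) set) = card {w \<in> PW n. tirr w}"
proof -
  \<comment> \<open>The \<open>{False}\<close> equations are led by the reducible words, the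
    \<open>{True}\<close> equations by the words that are irreducible but not totally
    irreducible.\<close>
  define C where "C w A \<longleftrightarrow>
      (\<exists>u v. irr u \<and> packed v \<and> v \<noteq> [] \<and> w = sconc u v \<and> A = shifted_shuffles {False} u v) \<or>
      (\<exists>u v. tirr u \<and> packed v \<and> v \<noteq> [] \<and> w = pconc u v \<and> A = shifted_shuffles {True} u v)" for w A
  let ?S = "{w \<in> PW n. tirr w}"
  have pair: "word_pair n u v" if "irr u" "packed v" "v \<noteq> []" "sconc u v \<in> PW n" for u v
    using that by (auto simp: word_pair_def PW_def irr_def)
  have pair': "word_pair n u v" if "tirr u" "packed v" "v \<noteq> []" "pconc u v \<in> PW n" for u v
    using that tirr_packed(1,2)[OF that(1)] by (auto simp: word_pair_def PW_def)
  have not_irr: "\<not> irr (sconc u v)" if "irr u" "packed v" "v \<noteq> []" for u v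
    using that decomp_sconc by (auto simp: irr_def)
  have eq: "(\<forall>u v. word_pair n u v \<longrightarrow> (\<Sum>x\<in>shifted_shuffles {True} u v. Poly_Mapping.lookup p x) = 0) \<and>
      (\<forall>u v. word_pair n u v \<longrightarrow> (\<Sum>x\<in>shifted_shuffles {False} u v. Poly_Mapping.lookup p x) = 0)
      \<longleftrightarrow> (\<forall>w\<in>PW n - ?S. \<forall>A. C w A \<longrightarrow> (\<Sum>x\<in>A. Poly_Mapping.lookup p x) = 0)"
    (is "?P1 \<and> ?P2 \<longleftrightarrow> ?Q") for p :: "nat list \<Rightarrow>\<^sub>0 'k"
  proof
    assume "?P1 \<and> ?P2"
    then show ?Q
      using pair pair' unfolding C_def by blast
  next
    assume A: ?Q
    have "(\<Sum>x\<in>shifted_shuffles {False} u v. Poly_Mapping.lookup p x) = 0"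
      if "irr u" "word_pair n u v" for u v
    proof -
      have v: "packed u" "packed v" "u \<noteq> []" "v \<noteq> []" "length u + length v = n"
        using that(2) by (auto simp: word_pair_def)
      have "sconc u v \<in> PW n" "\<not> tirr (sconc u v)"
        using v packed_sconc not_irr[OF that(1) v(2,4)] by (auto simp: PW_def tirr_def)
      moreover have "C (sconc u v) (shifted_shuffles {False} u v)"
        unfolding C_def using that(1) v by blast
      ultimately show ?thesis
        using A by blast
    qed
    then have suc: "(\<Sum>x\<in>shifted_shuffles {False} u v. Poly_Mapping.lookup p x) = 0"
      if "word_pair n u v" for u v
      using sum_shifted_shuffles_irr_reduction[where n = n and S = "{False}"] that by blast
    have "(\<Sum>x\<in>shifted_shuffles {True} u v. Poly_Mapping.lookup p x) = 0"
      if "tirr u" "word_pair n u v" for u v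
    proof -
      have v: "packed u" "packed v" "u \<noteq> []" "v \<noteq> []" "length u + length v = n"
        using that(2) by (auto simp: word_pair_def)
      have "pconc u v \<in> PW n" "\<not> tirr (pconc u v)"
        using v packed_pconc pdecomp_pconc by (auto simp: PW_def tirr_def)
      moreover have "C (pconc u v) (shifted_shuffles {True} u v)"
        unfolding C_def using that(1) v by blast
      ultimately show ?thesis
        using A by blast
    qed
    then show "?P1 \<and> ?P2"
      using sum_shifted_shuffles_tirr_reduction[where n = n and f = "Poly_Mapping.lookup p"] suc by blast
  qed
  have "TPrim n = {p :: nat list \<Rightarrow>\<^sub>0 'k. Poly_Mapping.keys p \<subseteq> PW n \<and>
      (\<forall>w\<in>PW n - ?S. \<forall>A. C w A \<longrightarrow> (\<Sum>x\<in>A. Poly_Mapping.lookup p x) = 0)}"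
  proof (rule set_eqI)
    fix p :: "nat list \<Rightarrow>\<^sub>0 'k"
    show "p \<in> TPrim n \<longleftrightarrow> p \<in> {p. Poly_Mapping.keys p \<subseteq> PW n \<and>
      (\<forall>w\<in>PW n - ?S. \<forall>A. C w A \<longrightarrow> (\<Sum>x\<in>A. Poly_Mapping.lookup p x) = 0)}"
      unfolding mem_Collect_eq eq[of p, symmetric] cut_map_eq_0_iff[symmetric]
      using n Delta_eq_cut_map(1,2)[of p n] by (auto simp: TPrim_def WQSym_def)
  qed
  also have "free_vs.dim \<dots> = card ?S"
  proof (rule dim_leading_constraints[OF finite_PW])
    show "\<exists>A. C w A" if w: "w \<in> PW n - ?S" for w
    proof (cases "irr w")
      case True
      then obtain u v where "tirr u" "packed v" "v \<noteq> []" "w = pconc u v"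
        using irr_not_tirr_pconc w by blast
      then show ?thesis unfolding C_def by blast
    next
      case False
      have "packed w" "w \<noteq> []" using w n by (auto simp: PW_def)
      then obtain u v where "irr u" "packed v" "v \<noteq> []" "w = sconc u v"
        using not_irr_sconc False by blast
      then show ?thesis unfolding C_def by blast
    qed
    show "A = B" if "C w A" "C w B" for w A B
    proof -
      \<comment> \<open>Keeps the two families apart: a word leading a \<open>{True}\<close>
        equation is irreducible, one leading a \<open>{False}\<close> equation is not.\<close>
      have irr: "irr (pconc u v)" if "tirr u" "packed v" for u v
        using that irr_pconc tirr_packed(3) by blast
      show ?thesis
        using that unfolding C_def
        by (elim disjE exE conjE) (metis sconc_irr_unique pconc_tirr_unique irr not_irr)+
    qed
    show "w \<in> A \<and> A \<subseteq> {x \<in> PW n. w \<le> x}" if w: "w \<in> PW n - ?S" and "C w A" for w A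
      using \<open>C w A\<close> unfolding C_def
    proof (elim disjE exE conjE)
      fix u v assume uv: "irr u" "packed v" "v \<noteq> []" "w = sconc u v" "A = shifted_shuffles {False} u v"
      then show ?thesis
        using pair[of u v] shifted_shuffles_above[of n u v "{False}" w] sconc_le_shifted_shuffle
          sconc_in_shifted_shuffles(1)[of v u] w by blast
    next
      fix u v assume uv: "tirr u" "packed v" "v \<noteq> []" "w = pconc u v" "A = shifted_shuffles {True} u v"
      then show ?thesis
        using pair'[of u v] shifted_shuffles_above[of n u v "{True}" w] pconc_le_shifted_shuffle
          pconc_in_shifted_shuffles[of v u] w tirr_packed(2) by blast
    qed
  qed auto
  finally show ?thesis .
qed

theorem mainTheorem2:
  fixes n :: nat
  shows "free_vs.dim (WQSym n :: (nat list \<Rightarrow>\<^sub>0 'k::field) set) = card (blue_packed_forests n)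
    \<and> free_vs.dim (Prim n :: (nat list \<Rightarrow>\<^sub>0 'k) set) = card (blue_packed_trees n)
    \<and> free_vs.dim (TPrim n :: (nat list \<Rightarrow>\<^sub>0 'k) set)
        = card {t \<in> blue_packed_trees n. left_forest t = []}"
proof (cases "n = 0")
  case True
  \<comment> \<open>In degree 0 both primitive spaces are \<open>{0}\<close> by convention, matching
    the absence of trees without nodes; the empty word still corresponds to the empty
    forest.\<close>
  have "blue_packed_trees 0 = {}"
    using tree_size_pos by (auto simp: blue_packed_trees_def)
  moreover have "free_vs.dim {0 :: nat list \<Rightarrow>\<^sub>0 'k} = 0"
    by (rule free_vs.dim_unique[of "{}"]) (auto simp: free_vs.independent_empty)
  ultimately show ?thesis
    using True dim_WQSym[of n, where ?'k = 'k] card_blue_packed_forests[of n]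
    by (simp add: Prim_def TPrim_def)
next
  case False
  then show ?thesis
    using dim_WQSym[of n, where ?'k = 'k] dim_Prim[of n, where ?'k = 'k]
      dim_TPrim[of n, where ?'k = 'k] card_blue_packed_forests[of n] card_blue_packed_trees[of n]
      card_blue_packed_trees_left_Nil[of n]
    by simp
qed

end
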